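(* In the model of the context let $$f(x)=\frac{x}{\theta(x+x^* )},\qquad \theta>0,\quad \theta x^*\in(0,1],\quad \theta x^*\ge 1-\theta .$$ Define the probability measure $\widehat{P}$ by $\widehat{P}=P$ if $\beta>0$; $\widehat{P}=P$ if $\beta=0$ and $\theta x^*=1$; and $\widehat{P}=P(\,\cdot\mid\mathbf{Z}_0\ne\mathbf{0})$ if $\beta=0$ and $\theta x^*<1$ (assuming $P(\mathbf{Z}_0\neq\mathbf{0})>0$ in this last case). Define $z_\infty=\frac{1-\theta x^*}{\theta}$ if $\beta=0$, and, if $\beta>0$, $$z_\infty=\hat z=\frac{-[(1-\alpha)\theta x^*-\beta\theta q-(1-\alpha-\beta)]+\sqrt{\Delta}}{2(1-\alpha)\theta}\in(0,1),$$ where $\Delta=[(1-\alpha)\theta x^*-\beta\theta q-(1-\alpha-\beta)]^2+4(1-\alpha)\beta\theta^2qx^*$. Then, under $\widehat{P}$, the system almost surely asymptotically synchronizes (the almost sure limit of $\mathbf{Z}_n$ has all components equal) and it is predictable (the almost sure limit of $\mathbf{Z}_n$ is a single deterministic point): indeed, $\widehat{P}$-almost surely, $$\mathbf{Z}_n\longrightarrow z_\infty\mathbf{1}\qquad\text{and}\qquad \frac1n\sum_{k=1}^n\mathbf{I}_k\longrightarrow z_\infty\mathbf{1}.$$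
   Context: Model. Let $N\ge 2$, $\alpha,\beta\in[0,1)$ with $\alpha+\beta\in(0,1)$, $q\in(0,1]$, and let $f:[0,1]\to[0,1]$ be the given strictly increasing $\mathcal{C}^1$ function. Let $(r_n)_{n\ge0}$ be a deterministic sequence with $r_n\sim 1/n$, i.e. $\lim_{n\to\infty} n r_n=1$. Let $Z_{0,h}$, $1\le h\le N$, be random variables with values in $[0,1]$. For $n\ge 0$ and $1\le h\le N$ set $Z_{n+1,h}=(1-r_n)Z_{n,h}+r_nI_{n+1,h}$ (the processes $(Z_{n,h})_n$ take values in $[0,1]$), where the $I_{n+1,h}$ take values in $\{0,1\}$ and, given $\mathcal{F}_n=\sigma(Z_{0,h}:1\le h\le N)\vee\sigma(I_{k,h}:1\le k\le n,\,1\le h\le N)$, the variables $I_{n+1,1},\dots,I_{n+1,N}$ are conditionally independent with $$P(I_{n+1,h}=1\mid\mathcal{F}_n)=\alpha Z_n+\beta q+(1-\alpha-\beta)f(Z_{n,h}),\qquad Z_n=\frac1N\sum_{i=1}^N Z_{n,i}.$$ Write $\mathbf{Z}_n=(Z_{n,1},\dots,Z_{n,N})^\top$, $\mathbf{I}_n=(I_{n,1},\dots,I_{n,N})^\top$, and let $\mathbf{0}$, $\mathbf{1}$ be the vectors with all components equal to $0$, respectively $1$.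
   Formalization: If β=0 and θx*<1, it is additionally assumed that 0≤r_n<1 for all n and Σ_n∏_{k<n}(1−r_k)=∞ (the claim can fail without these); ẑ∈(0,1) is replaced by ẑ∈(0,1], with ẑ<1 unless q=1 and θx*=1−θ, where ẑ=1. *)

theory Defs
  imports "HOL-Probability.Probability"
begin

definition history ::
  "'a measure \<Rightarrow> (nat \<Rightarrow> 'a \<Rightarrow> real ^ 'n) \<Rightarrow> (nat \<Rightarrow> 'a \<Rightarrow> real ^ 'n) \<Rightarrow> nat \<Rightarrow> 'a measure" where
  "history M Z I n = sigma (space M)
     ({(\<lambda>\<omega>. Z 0 \<omega> $ h) -` A \<inter> space M | h A. A \<in> sets borel} \<union>
      {(\<lambda>\<omega>. I k \<omega> $ h) -` A \<inter> space M | k h A. 1 \<le> k \<and> k \<le> n \<and> A \<in> sets borel})"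

definition cprob :: "'a measure \<Rightarrow> 'a measure \<Rightarrow> ('a \<Rightarrow> real) \<Rightarrow> real set \<Rightarrow> 'a \<Rightarrow> real" where
  "cprob M F X B = real_cond_exp M F (indicator {\<omega> \<in> space M. X \<omega> \<in> B})"

text \<open>Conditional independence given \<open>F\<close> of a finite family of real random variables. Subfamilies
  are covered by taking \<open>B h = UNIV\<close> for the remaining indices.\<close>

definition cond_indep_vars ::
  "'a measure \<Rightarrow> 'a measure \<Rightarrow> ('n::finite \<Rightarrow> 'a \<Rightarrow> real) \<Rightarrow> bool" where
  "cond_indep_vars M F X \<longleftrightarrow>
     (\<forall>B. (\<forall>h. B h \<in> sets borel) \<longrightarrow>
        (AE \<omega> in M. real_cond_exp M F (indicator {\<omega> \<in> space M. \<forall>h. X h \<omega> \<in> B h}) \<omega>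
           = (\<Prod>h\<in>UNIV. cprob M F (X h) (B h) \<omega>)))"

definition comp_mean :: "real ^ 'n \<Rightarrow> real" where
  "comp_mean z = (\<Sum>i\<in>UNIV. z $ i) / real CARD('n)"

text \<open>The number of components is \<open>CARD('n)\<close>. The variable \<open>I 0\<close> plays no role.\<close>

locale interacting_system = prob_space M
  for M :: "'a measure" +
  fixes \<alpha> \<beta> q :: real and f :: "real \<Rightarrow> real" and r :: "nat \<Rightarrow> real"
    and Z I :: "nat \<Rightarrow> 'a \<Rightarrow> real ^ 'n"
  assumes card_ge_2: "2 \<le> CARD('n)"
    and alpha: "0 \<le> \<alpha>" "\<alpha> < 1"
    and beta: "0 \<le> \<beta>" "\<beta> < 1"
    and alpha_beta: "0 < \<alpha> + \<beta>" "\<alpha> + \<beta> < 1"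
    and q: "0 < q" "q \<le> 1"
    and f_range: "f ` {0..1} \<subseteq> {0..1}"
    and f_mono: "strict_mono_on {0..1} f"
    and f_C1: "\<exists>f'. continuous_on {0..1} f' \<and>
                 (\<forall>x\<in>{0..1}. (f has_real_derivative f' x) (at x within {0..1}))"
    and r_asymp: "(\<lambda>n. real n * r n) \<longlonglongrightarrow> 1"
    and Z0_measurable: "Z 0 \<in> borel_measurable M"
    and I_measurable: "I (Suc n) \<in> borel_measurable M"
    and Z_range: "\<omega> \<in> space M \<Longrightarrow> 0 \<le> Z n \<omega> $ h \<and> Z n \<omega> $ h \<le> 1"
    and I_range: "\<omega> \<in> space M \<Longrightarrow> I (Suc n) \<omega> $ h \<in> {0, 1}"
    and Z_Suc: "\<omega> \<in> space M \<Longrightarrow>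
                  Z (Suc n) \<omega> $ h = (1 - r n) * Z n \<omega> $ h + r n * I (Suc n) \<omega> $ h"
    and I_cond_indep: "cond_indep_vars M (history M Z I n) (\<lambda>h \<omega>. I (Suc n) \<omega> $ h)"
    and I_cond_prob: "AE \<omega> in M. cprob M (history M Z I n) (\<lambda>\<omega>. I (Suc n) \<omega> $ h) {1} \<omega>
                        = \<alpha> * comp_mean (Z n \<omega>) + \<beta> * q + (1 - \<alpha> - \<beta>) * f (Z n \<omega> $ h)"

definition as_synchronizes :: "'a measure \<Rightarrow> (nat \<Rightarrow> 'a \<Rightarrow> real ^ 'n) \<Rightarrow> bool" where
  "as_synchronizes P Z \<longleftrightarrow>
     (AE \<omega> in P. \<exists>l. (\<lambda>n. Z n \<omega>) \<longlonglongrightarrow> l \<and> (\<forall>h k. l $ h = l $ k))"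

definition predictable :: "'a measure \<Rightarrow> (nat \<Rightarrow> 'a \<Rightarrow> real ^ 'n) \<Rightarrow> bool" where
  "predictable P Z \<longleftrightarrow> (\<exists>l. AE \<omega> in P. (\<lambda>n. Z n \<omega>) \<longlonglongrightarrow> l)"

definition sat :: "real \<Rightarrow> real \<Rightarrow> real \<Rightarrow> real" where
  "sat \<theta> xs x = x / (\<theta> * (x + xs))"

definition Phat ::
  "'a measure \<Rightarrow> real \<Rightarrow> real \<Rightarrow> real \<Rightarrow> (nat \<Rightarrow> 'a \<Rightarrow> real ^ 'n) \<Rightarrow> 'a measure" where
  "Phat M \<beta> \<theta> xs Z =
     (if \<beta> = 0 \<and> \<theta> * xs < 1 then uniform_measure M {\<omega> \<in> space M. Z 0 \<omega> \<noteq> 0} else M)"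

definition lin_coeff :: "real \<Rightarrow> real \<Rightarrow> real \<Rightarrow> real \<Rightarrow> real \<Rightarrow> real" where
  "lin_coeff \<alpha> \<beta> q \<theta> xs = (1 - \<alpha>) * \<theta> * xs - \<beta> * \<theta> * q - (1 - \<alpha> - \<beta>)"

definition discr :: "real \<Rightarrow> real \<Rightarrow> real \<Rightarrow> real \<Rightarrow> real \<Rightarrow> real" where
  "discr \<alpha> \<beta> q \<theta> xs = (lin_coeff \<alpha> \<beta> q \<theta> xs)\<^sup>2 + 4 * (1 - \<alpha>) * \<beta> * \<theta>\<^sup>2 * q * xs"

text \<open>The larger root of
  \<open>(1 - \<alpha>) * z = \<beta> * q + (1 - \<alpha> - \<beta>) * sat \<theta> xs z\<close>, cleared of the denominator.\<close>

definition zhat :: "real \<Rightarrow> real \<Rightarrow> real \<Rightarrow> real \<Rightarrow> real \<Rightarrow> real" where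
  "zhat \<alpha> \<beta> q \<theta> xs =
     (- lin_coeff \<alpha> \<beta> q \<theta> xs + sqrt (discr \<alpha> \<beta> q \<theta> xs)) / (2 * (1 - \<alpha>) * \<theta>)"

definition z_inf :: "real \<Rightarrow> real \<Rightarrow> real \<Rightarrow> real \<Rightarrow> real \<Rightarrow> real" where
  "z_inf \<alpha> \<beta> q \<theta> xs = (if \<beta> = 0 then (1 - \<theta> * xs) / \<theta> else zhat \<alpha> \<beta> q \<theta> xs)"

end

theory Submission
  imports Defs
begin

text \<open>Since \<open>\<Sum> (r n)\<^sup>2 < \<infinity>\<close>, the accumulated noise converges almost surely, so up to a null
  sequence each path satisfies a recursion with drift
  \<open>\<alpha> * (mean - z h) + drift (z h)\<close> in component \<open>h\<close>. At the smallest of the lower limits of the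
  components the mean-field term is nonnegative, which forces \<open>drift \<le> 0\<close> there; dually
  \<open>drift \<ge> 0\<close> at the largest of the upper limits. As \<open>drift\<close> is positive to the left and negative
  to the right of \<open>z_inf\<close>, both are \<open>z_inf\<close>, and synchronization need not be shown separately.

  The only exception is the unstable zero \<open>0\<close> of \<open>drift\<close> for \<open>\<beta> = 0\<close>, \<open>\<theta> * xs < 1\<close>. Near \<open>0\<close> the
  conditional mean of the next successes is at least \<open>\<gamma> * mean\<close> with \<open>\<gamma> > 1\<close>, and an exponential
  supermartingale shows that after each success the mean escapes from \<open>[0, \<epsilon>]\<close> with a probability
  bounded below. Successes do not stop, because \<open>\<Prod>k<n. 1 - r k\<close> is not summable. Once the mean
  stays away from \<open>0\<close>, the interaction \<open>\<alpha> > 0\<close> keeps every component away from \<open>0\<close>.\<close>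

subsection \<open>Recursions with vanishing steps\<close>

text \<open>Near the unstable zero the noise degenerates together with the drift: the conditional
  variance of a success is at most of the order of the mean, so noise does not simply push the path
  away, and convergence of the accumulated noise says nothing about escape. The mean just after a
  success at time \<open>k\<close> is only known to be of order \<open>1 / k\<close>, which is why
  the exponential weights start proportionally to \<open>k\<close>: this makes the chance of escape
  bounded below uniformly in \<open>k\<close>. A second obstacle is that the event of staying small
  belongs to no single \<open>hist n\<close>. It is therefore approximated by events of finite
  horizon, and a uniform contraction factor replaces a zero-one law. All path arguments compare the
  process with a recursion driven by conditional means alone, and they use only that such a
  recursion cannot jump over a strip once its steps are small.\<close>

text \<open>Once the errors \<open>y - x\<close> and the steps \<open>r n * C\<close> are smaller
  than a quarter of the strip, a single visit above \<open>b\<close> suffices. To leave through the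
  bottom, \<open>y\<close> would have to cross a zone that one step cannot jump over, and there
  \<open>x\<close> lies in the strip, so \<open>d\<close> is nonnegative.\<close>

lemma eventually_ge_if_frequently_gt:
  fixes x y d r :: "nat \<Rightarrow> real"
  assumes close: "(\<lambda>n. y n - x n) \<longlonglongrightarrow> 0"
    and step: "\<And>n. y (Suc n) = y n + r n * d n"
    and r_nonneg: "eventually (\<lambda>n. 0 \<le> r n) sequentially" and r_lim: "r \<longlonglongrightarrow> 0"
    and d_bound: "\<And>n. \<bar>d n\<bar> \<le> C"
    and "a < b"
    and drift: "eventually (\<lambda>n. a \<le> x n \<and> x n \<le> b \<longrightarrow> 0 \<le> d n) sequentially"
    and freq: "frequently (\<lambda>n. b < x n) sequentially"
  shows "eventually (\<lambda>n. a \<le> x n) sequentially"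
proof -
  define \<eta> where "\<eta> = (b - a) / 4"
  have eta: "0 < \<eta>" "b = a + 4 * \<eta>" using \<open>a < b\<close> by (simp_all add: \<eta>_def field_simps)
  have C: "0 \<le> C" using d_bound[of 0] by linarith
  have "(\<lambda>n. r n * C) \<longlonglongrightarrow> 0" using tendsto_mult_right[OF r_lim, of C] by simp
  then have "eventually (\<lambda>n. r n * C < \<eta>) sequentially"
    using eta order_tendstoD(2) by blast
  moreover have "eventually (\<lambda>n. \<bar>y n - x n\<bar> < \<eta>) sequentially"
    using tendstoD[OF close eta(1)] by (simp add: dist_real_def)
  ultimately have "eventually (\<lambda>n. r n * C < \<eta> \<and> \<bar>y n - x n\<bar> < \<eta> \<and> 0 \<le> r n
      \<and> (a \<le> x n \<and> x n \<le> b \<longrightarrow> 0 \<le> d n)) sequentially"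
    using r_nonneg drift by eventually_elim auto
  then obtain K where K: "\<And>n. n \<ge> K \<Longrightarrow> r n * C < \<eta> \<and> \<bar>y n - x n\<bar> < \<eta> \<and> 0 \<le> r n
      \<and> (a \<le> x n \<and> x n \<le> b \<longrightarrow> 0 \<le> d n)"
    unfolding eventually_sequentially by blast
  obtain m where m: "m \<ge> K" "b < x m"
    using freq unfolding frequently_sequentially by blast
  \<comment> \<open>The margin \<eta> above \<open>a\<close> covers the distance between
    \<open>x\<close> and \<open>y\<close>. Below \<open>a + 2 * \<eta>\<close> the point
    \<open>x\<close> is in the strip and \<open>y\<close> does not decrease; above it, one step
    loses less than \<eta>.\<close>
  have y_ge: "a + \<eta> \<le> y n" if "n \<ge> m" for n
    using that
  proof (induction n rule: dec_induct)
    case base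
    show ?case using K[of m] m eta by linarith
  next
    case (step n)
    then have Kn: "r n * C < \<eta>" "\<bar>y n - x n\<bar> < \<eta>" "0 \<le> r n" "a \<le> x n \<and> x n \<le> b \<longrightarrow> 0 \<le> d n"
      using K[of n] m by auto
    show ?case
    proof (cases "a + 2 * \<eta> \<le> y n")
      case True
      have "- (r n * C) \<le> r n * d n"
        using mult_left_mono[of "- C" "d n" "r n"] d_bound[of n] Kn(3) by (simp add: abs_le_iff)
      then show ?thesis using True Kn(1) assms(2)[of n] by linarith
    next
      case False
      then have "0 \<le> d n" using Kn eta step.IH by linarith
      then have "0 \<le> r n * d n" using Kn(3) by simp
      then show ?thesis using step.IH assms(2)[of n] by linarith
    qed
  qed
  have "a \<le> x n" if "n \<ge> m" for n
    using y_ge[OF that] K[of n] that m by linarith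
  then show ?thesis unfolding eventually_sequentially by blast
qed

text \<open>If \<open>x\<close> eventually stayed below a level inside the zone of positive drift,
  \<open>y\<close> would grow at least like \<open>c\<close> times the divergent sum of the steps,
  against the bound \<open>u\<close>. Hence \<open>x\<close> exceeds that level infinitely often,
  and the preceding lemma keeps it above \<open>b'\<close>.\<close>

lemma eventually_ge_if_positive_drift:
  fixes x y d r :: "nat \<Rightarrow> real"
  assumes close: "(\<lambda>n. y n - x n) \<longlonglongrightarrow> 0"
    and step: "\<And>n. y (Suc n) = y n + r n * d n"
    and r_nonneg: "eventually (\<lambda>n. 0 \<le> r n) sequentially" and r_lim: "r \<longlonglongrightarrow> 0"
    and r_div: "\<not> summable r"
    and d_bound: "\<And>n. \<bar>d n\<bar> \<le> C"
    and "b' < b" and "0 < c"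
    and x_le: "\<And>n. x n \<le> u"
    and x_ge: "eventually (\<lambda>n. a \<le> x n) sequentially"
    and drift: "eventually (\<lambda>n. a \<le> x n \<and> x n \<le> b \<longrightarrow> c \<le> d n) sequentially"
  shows "eventually (\<lambda>n. b' \<le> x n) sequentially"
proof -
  define e where "e = (b + b') / 2"
  have e: "b' < e" "e < b" using \<open>b' < b\<close> by (auto simp: e_def)
  have "frequently (\<lambda>n. e < x n) sequentially"
  proof (rule ccontr)
    assume "\<not> ?thesis"
    then have "eventually (\<lambda>n. x n \<le> e) sequentially"
      by (simp add: frequently_def not_less)
    moreover have "eventually (\<lambda>n. \<bar>y n - x n\<bar> < 1) sequentially"
      using tendstoD[OF close zero_less_one] by (simp add: dist_real_def)
    ultimately have "eventually (\<lambda>n. c \<le> d n \<and> 0 \<le> r n \<and> y n \<le> u + 1) sequentially"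
      using x_ge drift r_nonneg
    proof eventually_elim
      case (elim n)
      then show ?case using e x_le[of n] by auto
    qed
    then obtain K where K: "\<And>n. n \<ge> K \<Longrightarrow> c \<le> d n \<and> 0 \<le> r n \<and> y n \<le> u + 1"
      unfolding eventually_sequentially by blast
    have grow: "y K + c * (\<Sum>k<n. r (k + K)) \<le> y (n + K)" for n
    proof (induction n)
      case (Suc n)
      have "c * r (n + K) \<le> r (n + K) * d (n + K)"
        using mult_right_mono[of c "d (n + K)" "r (n + K)"] K[of "n + K"] by (simp add: mult.commute)
      then show ?case using Suc step[of "n + K"] by (simp add: algebra_simps)
    qed simp
    have "summable (\<lambda>k. r (k + K))"
    proof (rule bounded_imp_summable)
      show "0 \<le> r (k + K)" for k using K by simp
      fix n
      have "(\<Sum>k<Suc n. r (k + K)) * c \<le> u + 1 - y K"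
        using grow[of "Suc n"] K[of "Suc n + K"] by (simp add: mult.commute)
      then show "(\<Sum>k\<le>n. r (k + K)) \<le> (u + 1 - y K) / c"
        using \<open>0 < c\<close> by (simp add: pos_le_divide_eq lessThan_Suc_atMost)
    qed
    then show False using r_div summable_iff_shift by blast
  qed
  moreover have "eventually (\<lambda>n. b' \<le> x n \<and> x n \<le> e \<longrightarrow> 0 \<le> d n) sequentially"
    using x_ge drift by eventually_elim (use e \<open>0 < c\<close> in auto)
  ultimately show ?thesis
    using eventually_ge_if_frequently_gt[OF close step r_nonneg r_lim d_bound e(1)] by blast
qed

text \<open>If \<phi> were positive at \<open>l\<close>, every component near \<open>l\<close> would
  be pushed upwards, because the mean is at least \<open>l - \<eta>\<close> and so costs at most
  \<open>\<alpha> * (2 * \<eta>)\<close>. All components would then end up above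
  \<open>l + \<eta> / 2\<close>. The interval and \<phi> are left general: reflection gives the
  upper limits, and a positive \<open>lo\<close> excludes an unwanted zero at
  \<open>0\<close>.\<close>

lemma mean_field_lower_limit:
  fixes x y d :: "nat \<Rightarrow> 'n::finite \<Rightarrow> real" and r :: "nat \<Rightarrow> real"
  assumes close: "\<And>h. (\<lambda>n. y n h - x n h) \<longlonglongrightarrow> 0"
    and step: "\<And>n h. y (Suc n) h = y n h + r n * d n h"
    and r_nonneg: "eventually (\<lambda>n. 0 \<le> r n) sequentially" and r_lim: "r \<longlonglongrightarrow> 0"
    and r_div: "\<not> summable r"
    and d_bound: "\<And>n h. \<bar>d n h\<bar> \<le> C"
    and "0 \<le> \<alpha>"
    and d_eq: "\<And>n h. d n h = \<alpha> * ((\<Sum>i\<in>UNIV. x n i) / CARD('n) - x n h) + \<phi> (x n h)"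
    and cont: "continuous_on {lo..hi} \<phi>"
    and x_le: "\<And>n h. x n h \<le> hi"
    and x_ge: "eventually (\<lambda>n. \<forall>h. lo \<le> x n h) sequentially"
  obtains l where "lo \<le> l" "l \<le> hi" "\<phi> l \<le> 0"
    and "\<And>e h. 0 < e \<Longrightarrow> eventually (\<lambda>n. l - e < x n h) sequentially"
proof -
  \<comment> \<open>The supremum of the levels that eventually lie below all components is the
    smallest of their lower limits.\<close>
  define A where "A = {a. eventually (\<lambda>n. \<forall>h. a \<le> x n h) sequentially}"
  have lo: "lo \<in> A" using x_ge by (simp add: A_def)
  have A_le: "a \<le> hi" if a: "a \<in> A" for a
  proof -
    obtain n where "\<forall>h. a \<le> x n h"
      using a eventually_happens[of _ sequentially] by (auto simp: A_def)
    then show ?thesis using x_le order_trans by blast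
  qed
  then have bdd: "bdd_above A" by (rule bdd_aboveI)
  define l where "l = Sup A"
  have l_lo: "lo \<le> l" unfolding l_def using lo bdd by (rule cSup_upper)
  have l_hi: "l \<le> hi" unfolding l_def using lo A_le by (intro cSup_least) auto
  have ev: "eventually (\<lambda>n. \<forall>h. l - e < x n h) sequentially" if "0 < e" for e
  proof -
    from \<open>0 < e\<close> obtain a where a: "a \<in> A" "l - e < a"
      using less_cSupD[of A "l - e"] lo \<open>0 < e\<close> unfolding l_def by auto
    from a(1) have "eventually (\<lambda>n. \<forall>h. a \<le> x n h) sequentially" by (simp add: A_def)
    then show ?thesis by eventually_elim (use a(2) in \<open>auto intro: less_le_trans\<close>)
  qed
  have "\<phi> l \<le> 0"
  proof (rule ccontr)
    assume "\<not> \<phi> l \<le> 0"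
    then have pos: "0 < \<phi> l" by simp
    obtain \<delta> where \<delta>: "0 < \<delta>" "\<And>t. t \<in> {lo..hi} \<Longrightarrow> dist t l < \<delta> \<Longrightarrow> dist (\<phi> t) (\<phi> l) < \<phi> l / 2"
      using cont[unfolded continuous_on_iff, rule_format, of l "\<phi> l / 2"] l_lo l_hi pos by auto
    \<comment> \<open>The first bound keeps \<phi> above \<open>\<phi> l / 2\<close> on the strip,
      the second limits the loss through the mean to \<open>\<phi> l / 4\<close>; a drift of
      \<open>\<phi> l / 4\<close> remains.\<close>
    define \<eta> where "\<eta> = min (\<delta> / 2) (\<phi> l / (8 * (\<alpha> + 1)))"
    have eta: "0 < \<eta>" "\<eta> < \<delta>"
      using \<delta>(1) pos \<open>0 \<le> \<alpha>\<close> by (auto simp: \<eta>_def)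
    have "\<eta> \<le> \<phi> l / (8 * (\<alpha> + 1))" by (simp add: \<eta>_def)
    then have "\<eta> * (8 * (\<alpha> + 1)) \<le> \<phi> l"
      using \<open>0 \<le> \<alpha>\<close> by (subst (asm) pos_le_divide_eq) auto
    then have eta3: "\<alpha> * (2 * \<eta>) \<le> \<phi> l / 4"
      using eta(1) by (simp add: algebra_simps)
    have "eventually (\<lambda>n. l + \<eta> / 2 \<le> x n h) sequentially" for h
    proof (rule eventually_ge_if_positive_drift[where y = "\<lambda>n. y n h" and d = "\<lambda>n. d n h"
          and r = r and C = C and b = "l + \<eta>" and c = "\<phi> l / 4" and a = "l - \<eta>" and u = hi])
      show "eventually (\<lambda>n. l - \<eta> \<le> x n h) sequentially"
        using ev[OF eta(1)] by eventually_elim (auto intro: less_imp_le)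
      show "eventually (\<lambda>n. l - \<eta> \<le> x n h \<and> x n h \<le> l + \<eta> \<longrightarrow> \<phi> l / 4 \<le> d n h) sequentially"
        using ev[OF eta(1)] x_ge
      proof eventually_elim
        case (elim n)
        show ?case
        proof
          assume h: "l - \<eta> \<le> x n h \<and> x n h \<le> l + \<eta>"
          have "(\<Sum>i\<in>(UNIV::'n set). l - \<eta>) \<le> (\<Sum>i\<in>UNIV. x n i)"
            using elim by (intro sum_mono) (auto intro: less_imp_le)
          then have "l - \<eta> \<le> (\<Sum>i\<in>UNIV. x n i) / CARD('n)"
            by (simp add: pos_le_divide_eq mult.commute)
          then have "\<alpha> * (- (2 * \<eta>)) \<le> \<alpha> * ((\<Sum>i\<in>UNIV. x n i) / CARD('n) - x n h)"
            using h \<open>0 \<le> \<alpha>\<close> by (intro mult_left_mono) auto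
          moreover have "\<bar>\<phi> (x n h) - \<phi> l\<bar> < \<phi> l / 2"
            using \<delta>(2)[of "x n h"] h elim x_le eta by (auto simp: dist_real_def abs_le_iff)
          ultimately show "\<phi> l / 4 \<le> d n h" unfolding d_eq using eta3 by linarith
        qed
      qed
    qed (use eta pos close step r_nonneg r_lim r_div d_bound x_le in auto)
    then have "l + \<eta> / 2 \<in> A" by (simp add: A_def eventually_all_finite)
    then have "l + \<eta> / 2 \<le> l" unfolding l_def using bdd by (intro cSup_upper)
    then show False using eta by simp
  qed
  moreover have "eventually (\<lambda>n. l - e < x n h) sequentially" if "0 < e" for e h
    using ev[OF that] by eventually_elim auto
  ultimately show ?thesis using that l_lo l_hi by blast
qed

subsection \<open>Almost sure convergence of sums of orthogonal increments\<close>

text \<open>The value is frozen with its overshoot rather than cut off at \<open>e\<close>. Thus the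
  size of the current value records whether an exit has happened, and each increment is
  \<open>a n\<close> times a factor determined by the past.\<close>

primrec stopped_sum :: "real \<Rightarrow> (nat \<Rightarrow> real) \<Rightarrow> nat \<Rightarrow> real" where
  "stopped_sum e a 0 = 0"
| "stopped_sum e a (Suc n) =
     stopped_sum e a n + (if \<bar>stopped_sum e a n\<bar> < e then a n else 0)"

lemma stopped_sum_stays:
  assumes "e \<le> \<bar>stopped_sum e a m\<bar>" and "m \<le> n"
  shows "e \<le> \<bar>stopped_sum e a n\<bar>"
  using assms(2,1) by (induction n rule: dec_induct) auto

text \<open>Read contrapositively: if some partial sum up to \<open>n\<close> reaches
  \<open>e\<close>, the stopped sum at \<open>n\<close> still shows it. This carries a bound at one
  time over to the maximum.\<close>

lemma stopped_sum_cases: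
  "e \<le> \<bar>stopped_sum e a n\<bar> \<or>
    stopped_sum e a n = (\<Sum>i<n. a i) \<and> (\<forall>k\<le>n. \<bar>\<Sum>i<k. a i\<bar> < e)"
proof (induction n)
  case (Suc n)
  then show ?case
  proof (elim disjE conjE)
    assume *: "stopped_sum e a n = (\<Sum>i<n. a i)" "\<forall>k\<le>n. \<bar>\<Sum>i<k. a i\<bar> < e"
    then have "stopped_sum e a (Suc n) = (\<Sum>i<Suc n. a i)" by auto
    then show ?thesis
      using * by (cases "\<bar>\<Sum>i<Suc n. a i\<bar> < e") (auto simp: le_Suc_eq not_less)
  qed auto
qed auto

lemma abs_stopped_sum_le:
  assumes "\<And>n. \<bar>a n\<bar> \<le> b n"
  shows "\<bar>stopped_sum e a n\<bar> \<le> (\<Sum>i<n. b i)"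
proof (induction n)
  case (Suc n)
  have "0 \<le> b n" using assms[of n] abs_ge_zero order_trans by blast
  then show ?case using Suc assms[of n] by auto
qed simp

text \<open>Stopping the sum when it leaves \<open>(-e, e)\<close> keeps its increments orthogonal, so Chebyshev's
  inequality for the stopped sum is a maximal inequality for the original one.\<close>

lemma (in prob_space) AE_convergent_sum_orthogonal:
  fixes F :: "nat \<Rightarrow> 'a measure" and \<xi> :: "nat \<Rightarrow> 'a \<Rightarrow> real" and r :: "nat \<Rightarrow> real"
  assumes sub: "\<And>n. subalgebra M (F n)"
    and mono: "\<And>n. subalgebra (F (Suc n)) (F n)"
    and meas: "\<And>n. \<xi> n \<in> borel_measurable (F (Suc n))"
    and bound: "\<And>n \<omega>. \<omega> \<in> space M \<Longrightarrow> \<bar>\<xi> n \<omega>\<bar> \<le> 1"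
    and orth: "\<And>n g B. g \<in> borel_measurable (F n) \<Longrightarrow> (\<And>\<omega>. \<omega> \<in> space M \<Longrightarrow> \<bar>g \<omega>\<bar> \<le> B) \<Longrightarrow>
                 expectation (\<lambda>\<omega>. \<xi> n \<omega> * g \<omega>) = 0"
    and summ: "summable (\<lambda>n. (r n)\<^sup>2)"
  shows "AE \<omega> in M. convergent (\<lambda>n. \<Sum>k<n. r k * \<xi> k \<omega>)"
proof -
  define T where "T e m n \<omega> = stopped_sum e (\<lambda>i. r (i + m) * \<xi> (i + m) \<omega>) n" for e m n \<omega>
  have T_Suc: "T e m (Suc n) \<omega> =
      T e m n \<omega> + (if \<bar>T e m n \<omega>\<bar> < e then r (n + m) * \<xi> (n + m) \<omega> else 0)" for e m n \<omega>
    by (simp add: T_def)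
  have T_meas: "T e m n \<in> borel_measurable (F (n + m))" for e m n
  proof (induction n)
    case 0
    then show ?case by (simp add: T_def)
  next
    case (Suc n)
    note [measurable] = measurable_from_subalg[OF mono Suc] meas[of "n + m"]
    have "(\<lambda>\<omega>. T e m n \<omega> + (if \<bar>T e m n \<omega>\<bar> < e then r (n + m) * \<xi> (n + m) \<omega> else 0))
        \<in> borel_measurable (F (Suc (n + m)))"
      by measurable
    then show ?case by (simp add: T_Suc[abs_def])
  qed
  have T_M [measurable]: "T e m n \<in> borel_measurable M" for e m n
    using measurable_from_subalg[OF sub T_meas] .
  have xi_M [measurable]: "\<xi> n \<in> borel_measurable M" for n
    using measurable_from_subalg[OF sub meas] .
  have T_bound: "\<bar>T e m n \<omega>\<bar> \<le> (\<Sum>i<n. \<bar>r (i + m)\<bar>)" if "\<omega> \<in> space M" for e m n \<omega>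
    unfolding T_def
    by (rule abs_stopped_sum_le) (use bound[OF that] in \<open>simp add: abs_mult mult_left_le\<close>)
  have T_sq_bound: "(T e m n \<omega>)\<^sup>2 \<le> (\<Sum>i<n. \<bar>r (i + m)\<bar>)\<^sup>2" if "\<omega> \<in> space M" for e m n \<omega>
    using T_bound[OF that] by (metis abs_ge_zero power2_abs power_mono)
  have T_sq_int: "integrable M (\<lambda>\<omega>. (T e m n \<omega>)\<^sup>2)" for e m n
    by (rule integrable_const_bound[where B = "(\<Sum>i<n. \<bar>r (i + m)\<bar>)\<^sup>2"])
       (use T_sq_bound in auto)
  have var: "expectation (\<lambda>\<omega>. (T e m n \<omega>)\<^sup>2) \<le> (\<Sum>i<n. (r (i + m))\<^sup>2)" for e m n
  proof (induction n)
    case 0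
    then show ?case by (simp add: T_def)
  next
    case (Suc n)
    \<comment> \<open>The cross term of the new square is
      \<open>\<xi> (n + m) \<omega> * g \<omega>\<close>. The indicator moves the stopping rule into
      the factor \<open>g\<close>, which is known at time \<open>n + m\<close>, so that
      \<open>orth\<close> removes the term.\<close>
    define g where "g \<omega> = 2 * r (n + m) * T e m n \<omega> * indicator {- e<..<e} (T e m n \<omega>)" for \<omega>
    have g_meas: "g \<in> borel_measurable (F (n + m))"
      using T_meas[of e m n, measurable] unfolding g_def by measurable
    have g_M [measurable]: "g \<in> borel_measurable M"
      using measurable_from_subalg[OF sub g_meas] .
    define B where "B = 2 * \<bar>r (n + m)\<bar> * (\<Sum>i<n. \<bar>r (i + m)\<bar>)"
    have g_bound: "\<bar>g \<omega>\<bar> \<le> B" if "\<omega> \<in> space M" for \<omega>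
    proof -
      have "2 * \<bar>r (n + m)\<bar> * \<bar>T e m n \<omega>\<bar> \<le> B"
        unfolding B_def using T_bound[OF that] by (intro mult_left_mono) auto
      moreover have "0 \<le> B" unfolding B_def by (intro mult_nonneg_nonneg sum_nonneg) auto
      ultimately show ?thesis by (auto simp: g_def abs_mult split: split_indicator)
    qed
    have xig_int: "integrable M (\<lambda>\<omega>. \<xi> (n + m) \<omega> * g \<omega>)"
    proof (rule integrable_const_bound[where B = B])
      show "AE \<omega> in M. norm (\<xi> (n + m) \<omega> * g \<omega>) \<le> B"
      proof (rule AE_I2)
        fix \<omega> assume w: "\<omega> \<in> space M"
        show "norm (\<xi> (n + m) \<omega> * g \<omega>) \<le> B"
          using mult_mono[OF bound[OF w] g_bound[OF w]] by (simp add: abs_mult)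
      qed
    qed measurable
    have pw: "(T e m (Suc n) \<omega>)\<^sup>2 \<le> (T e m n \<omega>)\<^sup>2 + \<xi> (n + m) \<omega> * g \<omega> + (r (n + m))\<^sup>2"
      if "\<omega> \<in> space M" for \<omega>
    proof (cases "\<bar>T e m n \<omega>\<bar> < e")
      case True
      have "(r (n + m) * \<xi> (n + m) \<omega>)\<^sup>2 \<le> (r (n + m))\<^sup>2"
        using bound[OF that, of "n + m"]
        by (simp add: power_mult_distrib mult_left_le abs_square_le_1)
      then show ?thesis using True
        by (simp add: T_Suc g_def power2_sum algebra_simps abs_less_iff)
    next
      case False
      then show ?thesis by (auto simp: T_Suc g_def indicator_def)
    qed
    have "expectation (\<lambda>\<omega>. (T e m (Suc n) \<omega>)\<^sup>2)
        \<le> expectation (\<lambda>\<omega>. (T e m n \<omega>)\<^sup>2 + \<xi> (n + m) \<omega> * g \<omega> + (r (n + m))\<^sup>2)"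
      by (rule integral_mono) (use T_sq_int xig_int pw in auto)
    also have "\<dots> = expectation (\<lambda>\<omega>. (T e m n \<omega>)\<^sup>2) + expectation (\<lambda>\<omega>. \<xi> (n + m) \<omega> * g \<omega>)
        + (r (n + m))\<^sup>2"
      using T_sq_int xig_int by (simp add: prob_space)
    also have "expectation (\<lambda>\<omega>. \<xi> (n + m) \<omega> * g \<omega>) = 0"
      by (rule orth[OF g_meas g_bound])
    finally show ?case using Suc by simp
  qed
  define A where "A e m n = {\<omega> \<in> space M. e \<le> \<bar>T e m n \<omega>\<bar>}" for e m n
  have A_meas [measurable]: "A e m n \<in> sets M" for e m n
    unfolding A_def by measurable
  have prob_UN: "prob (\<Union>n. A e m n) \<le> (\<Sum>i. (r (i + m))\<^sup>2) / e\<^sup>2" if "0 < e" for e m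
  proof -
    have summ_m: "summable (\<lambda>i. (r (i + m))\<^sup>2)" using summ by (rule summable_ignore_initial_segment)
    have le: "prob (A e m n) \<le> (\<Sum>i. (r (i + m))\<^sup>2) / e\<^sup>2" for n
    proof -
      have "A e m n = {\<omega> \<in> space M. e\<^sup>2 \<le> (T e m n \<omega>)\<^sup>2}"
        using that by (auto simp: A_def abs_le_square_iff[symmetric])
      then have "prob (A e m n) \<le> expectation (\<lambda>\<omega>. (T e m n \<omega>)\<^sup>2) / e\<^sup>2"
        using integral_Markov_inequality_measure[OF T_sq_int[of e m n] sets.empty_sets, where c = "e\<^sup>2"] that
        by simp
      also have "\<dots> \<le> (\<Sum>i<n. (r (i + m))\<^sup>2) / e\<^sup>2"
        using var by (intro divide_right_mono) auto
      also have "\<dots> \<le> (\<Sum>i. (r (i + m))\<^sup>2) / e\<^sup>2"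
        using summ_m by (intro divide_right_mono sum_le_suminf) auto
      finally show ?thesis .
    qed
    have "incseq (A e m)"
      by (auto simp: incseq_def A_def T_def intro: stopped_sum_stays)
    then have "(\<lambda>n. prob (A e m n)) \<longlonglongrightarrow> prob (\<Union>n. A e m n)"
      using finite_Lim_measure_incseq[of "A e m"] by (auto simp: image_subset_iff)
    then show ?thesis using le by (intro LIMSEQ_le_const2) auto
  qed
  have null: "AE \<omega> in M. \<exists>m. \<omega> \<notin> (\<Union>n. A e m n)" if "0 < e" for e
  proof -
    \<comment> \<open>On \<open>N\<close> an excursion of size \<open>e\<close> occurs after every
      starting index \<open>m\<close>. Its probability is thus bounded by every tail of a convergent
      series, divided by \<open>e\<^sup>2\<close>.\<close>
    define N where "N = (\<Inter>m. \<Union>n. A e m n)"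
    have [measurable]: "N \<in> sets M" unfolding N_def by measurable
    have le: "prob N \<le> (\<Sum>i. (r (i + m))\<^sup>2) / e\<^sup>2" for m
    proof -
      have "prob N \<le> prob (\<Union>n. A e m n)"
        by (rule finite_measure_mono) (auto simp: N_def)
      then show ?thesis using prob_UN[OF that, of m] by linarith
    qed
    have "(\<lambda>m. (\<Sum>i. (r (i + m))\<^sup>2) / e\<^sup>2) \<longlonglongrightarrow> 0 / e\<^sup>2"
      using suminf_exist_split2[OF summ] by (intro tendsto_divide) (use that in auto)
    then have "prob N \<le> 0"
      using le by (intro LIMSEQ_le_const) auto
    then have "prob N = 0" using measure_nonneg[of M N] by linarith
    then have "AE \<omega> in M. \<omega> \<notin> N"
      using prob_eq_0[of N] by simp
    then show ?thesis by (auto simp: N_def)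
  qed
  have "AE \<omega> in M. \<forall>j. \<exists>m. \<omega> \<notin> (\<Union>n. A (1 / real (Suc j)) m n)"
    unfolding AE_all_countable by (intro allI null) simp
  then show ?thesis
  proof (rule AE_mp, intro AE_I2 impI)
    fix \<omega> assume w: "\<omega> \<in> space M" and all: "\<forall>j. \<exists>m. \<omega> \<notin> (\<Union>n. A (1 / real (Suc j)) m n)"
    define S where "S n = (\<Sum>k<n. r k * \<xi> k \<omega>)" for n
    have "Cauchy S"
    proof (rule metric_CauchyI)
      fix e :: real assume "0 < e"
      then obtain j where j: "1 / real (Suc j) < e / 2"
        using reals_Archimedean[of "e / 2"] by (auto simp: inverse_eq_divide)
      define c where "c = 1 / real (Suc j)"
      obtain m where "\<And>n. \<omega> \<notin> A c m n" using all c_def by auto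
      then have T_small: "\<bar>T c m n \<omega>\<bar> < c" for n using w by (auto simp: A_def not_le)
      have near: "\<bar>S (n + m) - S m\<bar> < c" for n
      proof -
        have "\<bar>\<Sum>i<n. r (i + m) * \<xi> (i + m) \<omega>\<bar> < c"
          using stopped_sum_cases[of c "\<lambda>i. r (i + m) * \<xi> (i + m) \<omega>" n] T_small[of n]
          by (auto simp: T_def)
        moreover have "S (n + m) = S m + (\<Sum>i<n. r (i + m) * \<xi> (i + m) \<omega>)"
          by (induction n) (auto simp: S_def)
        ultimately show ?thesis by simp
      qed
      have "dist (S a) (S b) < e" if "m \<le> a" "m \<le> b" for a b
        using near[of "a - m"] near[of "b - m"] that j unfolding c_def[symmetric] dist_real_def by simp
      then show "\<exists>m. \<forall>a\<ge>m. \<forall>b\<ge>m. dist (S a) (S b) < e" by blast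
    qed
    then show "convergent (\<lambda>n. \<Sum>k<n. r k * \<xi> k \<omega>)"
      by (simp add: Cauchy_convergent_iff S_def[abs_def])
  qed
qed

subsection \<open>Filtration and noise of the interacting system\<close>

lemma comp_mean_bounds:
  assumes "\<And>h. 0 \<le> z $ h \<and> z $ h \<le> 1"
  shows "0 \<le> comp_mean z" "comp_mean z \<le> 1"
proof -
  show "0 \<le> comp_mean z"
    unfolding comp_mean_def using assms by (intro divide_nonneg_nonneg sum_nonneg) auto
  have "(\<Sum>i\<in>UNIV. z $ i) \<le> (\<Sum>i\<in>(UNIV::'a set). 1)"
    using assms by (intro sum_mono) auto
  then show "comp_mean z \<le> 1" unfolding comp_mean_def by (simp add: divide_le_eq_1)
qed

lemma borel_measurable_vec_nth: "(\<lambda>x :: real ^ 'n. x $ h) \<in> borel_measurable borel"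
  by (intro borel_measurable_continuous_onI continuous_intros)

context interacting_system
begin

abbreviation hist :: "nat \<Rightarrow> 'a measure" where
  "hist \<equiv> history M Z I"

definition win_prob :: "nat \<Rightarrow> 'a \<Rightarrow> 'n \<Rightarrow> real" where
  "win_prob n \<omega> h = \<alpha> * comp_mean (Z n \<omega>) + \<beta> * q + (1 - \<alpha> - \<beta>) * f (Z n \<omega> $ h)"

lemma win_prob_bounds:
  assumes "\<omega> \<in> space M"
  shows "0 \<le> win_prob n \<omega> h" "win_prob n \<omega> h \<le> 1"
proof -
  have mean: "0 \<le> comp_mean (Z n \<omega>)" "comp_mean (Z n \<omega>) \<le> 1"
    using comp_mean_bounds[of "Z n \<omega>"] Z_range[OF assms] by auto
  have "f (Z n \<omega> $ h) \<in> {0..1}"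
    using f_range Z_range[OF assms, of n h] by (simp add: image_subset_iff)
  then have f01: "0 \<le> f (Z n \<omega> $ h)" "f (Z n \<omega> $ h) \<le> 1" by auto
  show "0 \<le> win_prob n \<omega> h"
    unfolding win_prob_def using mean f01 alpha beta alpha_beta q
    by (intro add_nonneg_nonneg mult_nonneg_nonneg) auto
  have "win_prob n \<omega> h \<le> \<alpha> * 1 + \<beta> * 1 + (1 - \<alpha> - \<beta>) * 1"
    unfolding win_prob_def using mean f01 alpha beta alpha_beta q
    by (intro add_mono mult_left_mono) auto
  then show "win_prob n \<omega> h \<le> 1" by simp
qed

lemma Z_0_component_measurable: "(\<lambda>\<omega>. Z 0 \<omega> $ h) \<in> borel_measurable M"
  by (rule measurable_compose[OF Z0_measurable borel_measurable_vec_nth])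

lemma I_component_measurable: "(\<lambda>\<omega>. I (Suc n) \<omega> $ h) \<in> borel_measurable M"
  by (rule measurable_compose[OF I_measurable borel_measurable_vec_nth])

lemma space_history [simp]: "space (hist n) = space M"
  unfolding history_def by (rule space_measure_of_conv)

lemma sets_history:
  "sets (hist n) = sigma_sets (space M)
     ({(\<lambda>\<omega>. Z 0 \<omega> $ h) -` A \<inter> space M | h A. A \<in> sets borel} \<union>
      {(\<lambda>\<omega>. I k \<omega> $ h) -` A \<inter> space M | k h A. 1 \<le> k \<and> k \<le> n \<and> A \<in> sets borel})"
  unfolding history_def by (rule sets_measure_of) auto

lemma subalgebra_history: "subalgebra M (hist n)"
proof -
  have "(\<lambda>\<omega>. I k \<omega> $ h) -` A \<inter> space M \<in> sets M" if "1 \<le> k" "A \<in> sets borel" for k h A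
    using that I_component_measurable[of "k - 1" h] by (auto intro: measurable_sets)
  then have "sets (hist n) \<subseteq> sets M"
    unfolding sets_history
    by (intro sets.sigma_sets_subset) (auto intro: measurable_sets[OF Z_0_component_measurable])
  then show ?thesis by (simp add: subalgebra_def)
qed

lemma history_mono:
  assumes "m \<le> n"
  shows "subalgebra (hist n) (hist m)"
proof -
  have "sets (hist m) \<subseteq> sets (hist n)"
    unfolding sets_history
    by (intro sigma_sets_mono' Un_mono order_refl) (use assms in \<open>blast intro: order_trans\<close>)
  then show ?thesis by (simp add: subalgebra_def)
qed

lemma I_measurable_history:
  assumes "1 \<le> k" "k \<le> n"
  shows "(\<lambda>\<omega>. I k \<omega> $ h) \<in> borel_measurable (hist n)"
proof (rule measurableI)
  show "(\<lambda>\<omega>. I k \<omega> $ h) -` A \<inter> space (hist n) \<in> sets (hist n)" if "A \<in> sets borel" for A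
    unfolding sets_history space_history using that assms by (intro sigma_sets.Basic) auto
qed auto

lemma Z_measurable_history: "(\<lambda>\<omega>. Z n \<omega> $ h) \<in> borel_measurable (hist n)"
proof (induction n)
  case 0
  show ?case
  proof (rule measurableI)
    show "(\<lambda>\<omega>. Z 0 \<omega> $ h) -` A \<inter> space (hist 0) \<in> sets (hist 0)" if "A \<in> sets borel" for A
      unfolding sets_history space_history using that by (intro sigma_sets.Basic) auto
  qed auto
next
  case (Suc n)
  note [measurable] = measurable_from_subalg[OF history_mono Suc, of "Suc n"]
    I_measurable_history[of "Suc n" "Suc n" h]
  have "(\<lambda>\<omega>. (1 - r n) * Z n \<omega> $ h + r n * I (Suc n) \<omega> $ h) \<in> borel_measurable (hist (Suc n))"
    by measurable
  then show ?case by (subst measurable_cong[OF Z_Suc]) auto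
qed

lemma comp_mean_measurable_history: "(\<lambda>\<omega>. comp_mean (Z n \<omega>)) \<in> borel_measurable (hist n)"
  unfolding comp_mean_def using Z_measurable_history[measurable] by measurable

lemma f_continuous: "continuous_on {0..1} f"
  using f_C1 by (meson DERIV_continuous continuous_on_eq_continuous_within)

lemma win_prob_measurable_history: "(\<lambda>\<omega>. win_prob n \<omega> h) \<in> borel_measurable (hist n)"
proof -
  \<comment> \<open>Continuity of \<open>f\<close> is available on the unit interval only. Clamping
    the argument gives a globally continuous function with the same values along the
    process.\<close>
  define g where "g x = f (max 0 (min 1 x))" for x
  have "continuous_on UNIV g"
    unfolding g_def by (rule continuous_on_compose2[OF f_continuous]) (auto intro!: continuous_intros)
  then have [measurable]: "g \<in> borel_measurable borel" by (rule borel_measurable_continuous_onI)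
  note [measurable] = Z_measurable_history comp_mean_measurable_history
  have "(\<lambda>\<omega>. \<alpha> * comp_mean (Z n \<omega>) + \<beta> * q + (1 - \<alpha> - \<beta>) * g (Z n \<omega> $ h))
      \<in> borel_measurable (hist n)"
    by measurable
  moreover have "win_prob n \<omega> h =
      \<alpha> * comp_mean (Z n \<omega>) + \<beta> * q + (1 - \<alpha> - \<beta>) * g (Z n \<omega> $ h)" if "\<omega> \<in> space (hist n)" for \<omega>
    using Z_range[of \<omega> n h] that by (simp add: win_prob_def g_def)
  ultimately show ?thesis by (subst measurable_cong) auto
qed

lemma I_bounds: "\<omega> \<in> space M \<Longrightarrow> 0 \<le> I (Suc n) \<omega> $ h \<and> I (Suc n) \<omega> $ h \<le> 1"
  using I_range[of \<omega> n h] by auto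

lemma integrable_bounded_history:
  assumes "g \<in> borel_measurable (hist n)" and "\<And>\<omega>. \<omega> \<in> space M \<Longrightarrow> \<bar>g \<omega>\<bar> \<le> B"
  shows "integrable M (g :: 'a \<Rightarrow> real)"
  using measurable_from_subalg[OF subalgebra_history assms(1)] assms(2)
  by (intro integrable_const_bound[where B = B]) auto

lemma integrable_I_mult:
  fixes g :: "'a \<Rightarrow> real"
  assumes "g \<in> borel_measurable (hist n)" and "\<And>\<omega>. \<omega> \<in> space M \<Longrightarrow> \<bar>g \<omega>\<bar> \<le> B"
  shows "integrable M (\<lambda>\<omega>. I (Suc n) \<omega> $ h * g \<omega>)"
proof (rule integrable_const_bound[where B = B])
  show "AE \<omega> in M. norm (I (Suc n) \<omega> $ h * g \<omega>) \<le> B"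
  proof (rule AE_I2)
    fix \<omega> assume "\<omega> \<in> space M"
    then show "norm (I (Suc n) \<omega> $ h * g \<omega>) \<le> B"
      using I_range[of \<omega> n h] assms(2)[of \<omega>] by auto
  qed
  show "(\<lambda>\<omega>. I (Suc n) \<omega> $ h * g \<omega>) \<in> borel_measurable M"
    using I_component_measurable[of n h] measurable_from_subalg[OF subalgebra_history assms(1)]
    by measurable
qed

lemma integrable_win_prob_mult:
  fixes g :: "'a \<Rightarrow> real"
  assumes g: "g \<in> borel_measurable (hist n)" and B: "\<And>\<omega>. \<omega> \<in> space M \<Longrightarrow> \<bar>g \<omega>\<bar> \<le> B"
  shows "integrable M (\<lambda>\<omega>. win_prob n \<omega> h * g \<omega>)"
proof (rule integrable_bounded_history[where B = B and n = n])
  show "(\<lambda>\<omega>. win_prob n \<omega> h * g \<omega>) \<in> borel_measurable (hist n)"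
    using g win_prob_measurable_history[of n h] by measurable
  fix \<omega> assume "\<omega> \<in> space M"
  then show "\<bar>win_prob n \<omega> h * g \<omega>\<bar> \<le> B"
    using mult_mono[of "\<bar>win_prob n \<omega> h\<bar>" 1 "\<bar>g \<omega>\<bar>" B] win_prob_bounds[of \<omega> n h] B[of \<omega>]
    by (simp add: abs_mult)
qed

text \<open>The conditional law of the successes is used in this integrated form. As
  \<open>I\<close> has values in \<open>{0, 1}\<close>, it is the indicator of the event
  \<open>I = 1\<close>, and a bounded factor known at time \<open>n\<close> can be moved into the
  conditional expectation.\<close>

lemma expectation_I_mult:
  fixes g :: "'a \<Rightarrow> real"
  assumes g: "g \<in> borel_measurable (hist n)" and B: "\<And>\<omega>. \<omega> \<in> space M \<Longrightarrow> \<bar>g \<omega>\<bar> \<le> B"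
  shows "expectation (\<lambda>\<omega>. I (Suc n) \<omega> $ h * g \<omega>) = expectation (\<lambda>\<omega>. win_prob n \<omega> h * g \<omega>)"
proof -
  interpret S: finite_measure_subalgebra M "hist n"
    by unfold_locales (rule subalgebra_history)
  define J :: "'a \<Rightarrow> real" where "J = indicator {\<omega> \<in> space M. I (Suc n) \<omega> $ h \<in> {1}}"
  have I_eq: "I (Suc n) \<omega> $ h = J \<omega>" if "\<omega> \<in> space M" for \<omega>
    using I_range[OF that, of n h] that by (auto simp: J_def indicator_def)
  have J_meas: "J \<in> borel_measurable M"
    using I_component_measurable[of n h] unfolding J_def by measurable
  have int: "integrable M (\<lambda>\<omega>. g \<omega> * J \<omega>)"
    using integrable_I_mult[OF g B, of h] I_eq
    by (subst Bochner_Integration.integrable_cong[OF refl, where g = "\<lambda>\<omega>. I (Suc n) \<omega> $ h * g \<omega>"])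
       (auto simp: mult.commute)
  have "expectation (\<lambda>\<omega>. I (Suc n) \<omega> $ h * g \<omega>) = expectation (\<lambda>\<omega>. g \<omega> * J \<omega>)"
    by (rule Bochner_Integration.integral_cong) (simp_all add: I_eq mult.commute)
  also have "\<dots> = expectation (\<lambda>\<omega>. g \<omega> * real_cond_exp M (hist n) J \<omega>)"
    using S.real_cond_exp_intg(2)[OF int g J_meas] by simp
  also have "\<dots> = expectation (\<lambda>\<omega>. win_prob n \<omega> h * g \<omega>)"
  proof (rule integral_cong_AE)
    show "(\<lambda>\<omega>. g \<omega> * real_cond_exp M (hist n) J \<omega>) \<in> borel_measurable M"
      using measurable_from_subalg[OF subalgebra_history g] by measurable
    show "(\<lambda>\<omega>. win_prob n \<omega> h * g \<omega>) \<in> borel_measurable M"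
      using integrable_win_prob_mult[OF g B] by (rule borel_measurable_integrable)
    show "AE \<omega> in M. g \<omega> * real_cond_exp M (hist n) J \<omega> = win_prob n \<omega> h * g \<omega>"
      using I_cond_prob[of n h] unfolding cprob_def J_def[symmetric] win_prob_def
      by eventually_elim simp
  qed
  finally show ?thesis .
qed

lemma r_lim: "r \<longlonglongrightarrow> 0"
proof -
  have "(\<lambda>n. real n * r n * (1 / real n)) \<longlonglongrightarrow> 1 * 0"
    by (intro tendsto_mult r_asymp lim_1_over_n)
  moreover have "eventually (\<lambda>n. real n * r n * (1 / real n) = r n) sequentially"
    using eventually_gt_at_top[of 0] by eventually_elim simp
  ultimately show ?thesis using Lim_transform_eventually by fastforce
qed

lemma r_eventually_bounds:
  "eventually (\<lambda>n. 0 < n \<and> 1 / (2 * real n) \<le> r n \<and> r n \<le> 2 / real n) sequentially"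
proof -
  have "eventually (\<lambda>n. 1 / 2 < real n * r n) sequentially"
    and "eventually (\<lambda>n. real n * r n < 2) sequentially"
    using order_tendstoD[OF r_asymp, of "1 / 2"] order_tendstoD[OF r_asymp, of 2] by simp_all
  moreover have "eventually (\<lambda>n. 0 < n) sequentially" by (rule eventually_gt_at_top)
  ultimately show ?thesis
    by eventually_elim (auto simp: field_simps)
qed

lemma r_eventually_nonneg: "eventually (\<lambda>n. 0 \<le> r n) sequentially"
  using r_eventually_bounds by eventually_elim (auto intro: order_trans[rotated])

lemma r_not_summable: "\<not> summable r"
proof
  assume "summable r"
  then have "summable (\<lambda>n. 2 * r n)" by (rule summable_mult)
  then have "summable (\<lambda>n. inverse (real n))"
  proof (rule summable_comparison_test_ev[rotated])
    show "eventually (\<lambda>n. norm (inverse (real n)) \<le> 2 * r n) sequentially"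
      using r_eventually_bounds by eventually_elim (auto simp: field_simps)
  qed
  then show False using not_summable_harmonic[where ?'a = real] by simp
qed

lemma r_square_summable: "summable (\<lambda>n. (r n)\<^sup>2)"
proof (rule summable_comparison_test_ev)
  show "summable (\<lambda>n. 4 * inverse ((real n)\<^sup>2))"
    using inverse_power_summable[of 2, where ?'a = real] by (intro summable_mult) auto
  show "eventually (\<lambda>n. norm ((r n)\<^sup>2) \<le> 4 * inverse ((real n)\<^sup>2)) sequentially"
    using r_eventually_bounds r_eventually_nonneg
  proof eventually_elim
    case (elim n)
    then have "(r n)\<^sup>2 \<le> (2 / real n)\<^sup>2" by (intro power_mono) auto
    then show ?case by (simp add: power_divide divide_inverse power_inverse)
  qed
qed

text \<open>The differences between successes and their conditional probabilities are bounded by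
  \<open>1\<close> and, by \<open>expectation_I_mult\<close>, orthogonal to everything known before;
  the squared weights are summable.\<close>

lemma AE_noise_convergent:
  "AE \<omega> in M. \<forall>h. convergent (\<lambda>n. \<Sum>k<n. r k * (I (Suc k) \<omega> $ h - win_prob k \<omega> h))"
proof -
  have "AE \<omega> in M. convergent (\<lambda>n. \<Sum>k<n. r k * (I (Suc k) \<omega> $ h - win_prob k \<omega> h))" for h
  proof (rule AE_convergent_sum_orthogonal[where F = hist])
    show "(\<lambda>\<omega>. I (Suc n) \<omega> $ h - win_prob n \<omega> h) \<in> borel_measurable (hist (Suc n))" for n
      using I_measurable_history[of "Suc n" "Suc n" h]
        measurable_from_subalg[OF history_mono win_prob_measurable_history, of n "Suc n" h]
      by measurable
    show "\<bar>I (Suc n) \<omega> $ h - win_prob n \<omega> h\<bar> \<le> 1" if "\<omega> \<in> space M" for n \<omega>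
      using I_bounds[OF that, of n h] win_prob_bounds[OF that, of n h] by (auto simp: abs_le_iff)
    show "expectation (\<lambda>\<omega>. (I (Suc n) \<omega> $ h - win_prob n \<omega> h) * g \<omega>) = 0"
      if g: "g \<in> borel_measurable (hist n)" "\<And>\<omega>. \<omega> \<in> space M \<Longrightarrow> \<bar>g \<omega>\<bar> \<le> B" for n g B
      using expectation_I_mult[OF g] integrable_I_mult[OF g] integrable_win_prob_mult[OF g]
      by (simp add: left_diff_distrib)
  qed (auto intro: subalgebra_history history_mono r_square_summable)
  then show ?thesis by (simp add: AE_all_countable)
qed

end

subsection \<open>Limits of single paths\<close>

lemma averages_tendsto_zero:
  fixes e :: "nat \<Rightarrow> real"
  assumes "e \<longlonglongrightarrow> 0"
  shows "(\<lambda>n. (\<Sum>k<n. e k) / real n) \<longlonglongrightarrow> 0"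
proof (rule LIMSEQ_I)
  fix \<epsilon> :: real assume "0 < \<epsilon>"
  obtain N where N: "\<And>k. k \<ge> N \<Longrightarrow> \<bar>e k\<bar> < \<epsilon> / 2"
    using LIMSEQ_D[OF assms, of "\<epsilon> / 2"] \<open>0 < \<epsilon>\<close> by auto
  define C where "C = (\<Sum>k<N. \<bar>e k\<bar>)"
  obtain K where K: "2 * C / \<epsilon> < real K" using reals_Archimedean2 by blast
  have "\<bar>(\<Sum>k<n. e k) / real n\<bar> < \<epsilon>" if n: "n \<ge> Suc (max N K)" for n
  proof -
    have "\<bar>\<Sum>k<n. e k\<bar> \<le> (\<Sum>k<n. \<bar>e k\<bar>)" by (rule sum_abs)
    also have "\<dots> = C + (\<Sum>k\<in>{N..<n}. \<bar>e k\<bar>)"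
      unfolding C_def using n
      by (subst sum.union_disjoint[symmetric]) (auto intro!: sum.cong)
    also have "(\<Sum>k\<in>{N..<n}. \<bar>e k\<bar>) \<le> (\<Sum>k\<in>{N..<n}. \<epsilon> / 2)"
      using N by (intro sum_mono) (auto intro: less_imp_le)
    also have "\<dots> \<le> real n * (\<epsilon> / 2)"
      using \<open>0 < \<epsilon>\<close> by (simp add: mult_right_mono)
    also have "C + real n * (\<epsilon> / 2) < real n * \<epsilon>"
    proof -
      have "2 * C < real K * \<epsilon>" using K \<open>0 < \<epsilon>\<close> by (simp add: pos_divide_less_eq)
      also have "\<dots> \<le> real n * \<epsilon>" using n \<open>0 < \<epsilon>\<close> by (intro mult_right_mono) auto
      finally show ?thesis by linarith
    qed
    finally show ?thesis using n by (simp add: pos_divide_less_eq mult.commute)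
  qed
  then show "\<exists>no. \<forall>n\<ge>no. norm ((\<Sum>k<n. e k) / real n - 0) < \<epsilon>" by auto
qed

text \<open>Up to the null sequence \<open>(1 - k * r k) * (i (Suc k) - z k)\<close>, the term \<open>i (Suc k)\<close> is
  \<open>z k + k * (z (Suc k) - z k)\<close>, which telescopes.\<close>

lemma averages_tendsto:
  fixes z i r :: "nat \<Rightarrow> real"
  assumes step: "\<And>n. z (Suc n) = (1 - r n) * z n + r n * i (Suc n)"
    and bound: "\<And>n. \<bar>i (Suc n) - z n\<bar> \<le> 1"
    and r: "(\<lambda>n. real n * r n) \<longlonglongrightarrow> 1"
    and z: "z \<longlonglongrightarrow> l"
  shows "(\<lambda>n. (\<Sum>k=1..n. i k) / real n) \<longlonglongrightarrow> l"
proof -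
  define e where "e k = (1 - real k * r k) * (i (Suc k) - z k)" for k
  have "(\<lambda>k. \<bar>1 - real k * r k\<bar>) \<longlonglongrightarrow> \<bar>1 - 1\<bar>"
    by (intro tendsto_intros r)
  then have "(\<lambda>k. \<bar>1 - real k * r k\<bar>) \<longlonglongrightarrow> 0" by simp
  then have "e \<longlonglongrightarrow> 0"
  proof (rule tendsto_0_le)
    show "eventually (\<lambda>k. norm (e k) \<le> norm \<bar>1 - real k * r k\<bar> * 1) sequentially"
      using bound by (intro always_eventually allI) (simp add: e_def abs_mult mult_left_le)
  qed
  then have e: "(\<lambda>n. (\<Sum>k<n. e k) / real n) \<longlonglongrightarrow> 0" by (rule averages_tendsto_zero)
  have sum_eq: "(\<Sum>k=1..n. i k) = real n * z n - z n + z 0 + (\<Sum>k<n. e k)" for n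
  proof (induction n)
    case (Suc n)
    have "i (Suc n) = (1 + real n) * z (Suc n) - real n * z n - (z (Suc n) - z n) + e n"
      unfolding e_def step[of n] by (simp add: algebra_simps)
    then show ?case using Suc by (simp add: algebra_simps)
  qed simp
  have "(\<lambda>n. z n + (z 0 - z n) * (1 / real n) + (\<Sum>k<n. e k) / real n) \<longlonglongrightarrow> l + (z 0 - l) * 0 + 0"
    by (intro tendsto_intros z e lim_1_over_n)
  moreover have "eventually (\<lambda>n. z n + (z 0 - z n) * (1 / real n) + (\<Sum>k<n. e k) / real n
      = (\<Sum>k=1..n. i k) / real n) sequentially"
    using eventually_gt_at_top[of 0] unfolding sum_eq by eventually_elim (simp add: field_simps)
  ultimately show ?thesis using Lim_transform_eventually by fastforce
qed

context interacting_system
begin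

text \<open>This is what remains of \<open>win_prob\<close> minus the component after the mean-field
  term is split off, whence the coefficient \<open>1 - \<alpha>\<close>. When all components agree
  the mean-field term vanishes, so the zeros of \<open>drift\<close> are the synchronized
  equilibria.\<close>

definition drift :: "real \<Rightarrow> real" where
  "drift x = \<beta> * q + (1 - \<alpha> - \<beta>) * f x - (1 - \<alpha>) * x"

definition noise :: "'a \<Rightarrow> nat \<Rightarrow> 'n \<Rightarrow> real" where
  "noise \<omega> n h = (\<Sum>k<n. r k * (I (Suc k) \<omega> $ h - win_prob k \<omega> h))"

text \<open>Subtracting the noise leaves a recursion driven by conditional probabilities alone.
  Adding back its limit, meaningful where the noise converges, makes the distance to
  \<open>Z\<close> vanish asymptotically.\<close>

definition compensated :: "'a \<Rightarrow> nat \<Rightarrow> 'n \<Rightarrow> real" where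
  "compensated \<omega> n h = Z n \<omega> $ h - noise \<omega> n h + lim (\<lambda>n. noise \<omega> n h)"

lemma drift_continuous: "continuous_on {0..1} drift"
  unfolding drift_def by (intro continuous_intros f_continuous)

lemma win_prob_minus_Z:
  "win_prob n \<omega> h - Z n \<omega> $ h =
     \<alpha> * ((\<Sum>i\<in>UNIV. Z n \<omega> $ i) / CARD('n) - Z n \<omega> $ h) + drift (Z n \<omega> $ h)"
  by (simp add: win_prob_def drift_def comp_mean_def algebra_simps)

lemma compensated_step:
  assumes "\<omega> \<in> space M"
  shows "compensated \<omega> (Suc n) h = compensated \<omega> n h + r n * (win_prob n \<omega> h - Z n \<omega> $ h)"
  using Z_Suc[OF assms, of n h] by (simp add: compensated_def noise_def algebra_simps)

lemma compensated_close:
  assumes "convergent (\<lambda>n. noise \<omega> n h)"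
  shows "(\<lambda>n. compensated \<omega> n h - Z n \<omega> $ h) \<longlonglongrightarrow> 0"
proof -
  have "(\<lambda>n. lim (\<lambda>n. noise \<omega> n h) - noise \<omega> n h) \<longlonglongrightarrow> lim (\<lambda>n. noise \<omega> n h) - lim (\<lambda>n. noise \<omega> n h)"
    using assms by (intro tendsto_diff tendsto_const) (simp add: convergent_LIMSEQ_iff)
  then show ?thesis by (simp add: compensated_def)
qed

lemma win_prob_minus_Z_bound:
  assumes "\<omega> \<in> space M"
  shows "\<bar>win_prob n \<omega> h - Z n \<omega> $ h\<bar> \<le> 1"
  using win_prob_bounds[OF assms, of n h] Z_range[OF assms, of n h] by (auto simp: abs_le_iff)

lemma Z_lower_limit:
  assumes w: "\<omega> \<in> space M" and conv: "\<And>h. convergent (\<lambda>n. noise \<omega> n h)"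
    and "0 \<le> lo" and lo: "eventually (\<lambda>n. \<forall>h. lo \<le> Z n \<omega> $ h) sequentially"
  obtains l where "lo \<le> l" "l \<le> 1" "drift l \<le> 0"
    and "\<And>e h. 0 < e \<Longrightarrow> eventually (\<lambda>n. l - e < Z n \<omega> $ h) sequentially"
proof (rule mean_field_lower_limit[where x = "\<lambda>n h. Z n \<omega> $ h" and y = "compensated \<omega>" and r = r
      and d = "\<lambda>n h. win_prob n \<omega> h - Z n \<omega> $ h" and C = 1 and \<alpha> = \<alpha> and \<phi> = drift
      and lo = lo and hi = 1])
  show "continuous_on {lo..1} drift"
    using drift_continuous by (rule continuous_on_subset) (use \<open>0 \<le> lo\<close> in auto)
qed (use that lo in \<open>auto intro: compensated_close conv compensated_step[OF w] r_eventually_nonneg r_lim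
      win_prob_minus_Z_bound[OF w] alpha win_prob_minus_Z simp: r_not_summable Z_range[OF w]\<close>)

text \<open>The reflection \<open>x\<close> to \<open>- x\<close> exchanges upper and lower limits
  and preserves the attraction to the mean; the interval becomes \<open>{- 1..0}\<close>.\<close>

lemma Z_upper_limit:
  assumes w: "\<omega> \<in> space M" and conv: "\<And>h. convergent (\<lambda>n. noise \<omega> n h)"
  obtains u where "0 \<le> u" "u \<le> 1" "0 \<le> drift u"
    and "\<And>e h. 0 < e \<Longrightarrow> eventually (\<lambda>n. Z n \<omega> $ h < u + e) sequentially"
proof (rule mean_field_lower_limit[where x = "\<lambda>n h. - (Z n \<omega> $ h)" and y = "\<lambda>n h. - compensated \<omega> n h"
      and r = r and d = "\<lambda>n h. - (win_prob n \<omega> h - Z n \<omega> $ h)" and C = 1 and \<alpha> = \<alpha>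
      and \<phi> = "\<lambda>x. - drift (- x)" and lo = "- 1" and hi = 0])
  show "continuous_on {- 1..0} (\<lambda>x. - drift (- x))"
    by (intro continuous_on_minus continuous_on_compose2[OF drift_continuous] continuous_intros) auto
  show "(\<lambda>n. - compensated \<omega> n h - - (Z n \<omega> $ h)) \<longlonglongrightarrow> 0" for h
    using tendsto_minus[OF compensated_close[OF conv, of h]] by simp
  show "- compensated \<omega> (Suc n) h = - compensated \<omega> n h + r n * - (win_prob n \<omega> h - Z n \<omega> $ h)" for n h
    using compensated_step[OF w, of n h] by (simp add: right_diff_distrib)
  show "\<bar>- (win_prob n \<omega> h - Z n \<omega> $ h)\<bar> \<le> 1" for n h
    using win_prob_minus_Z_bound[OF w, of n h] by simp
  show "- (win_prob n \<omega> h - Z n \<omega> $ h) = \<alpha> * ((\<Sum>i\<in>UNIV. - (Z n \<omega> $ i)) / CARD('n) - - (Z n \<omega> $ h))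
      + - drift (- (- (Z n \<omega> $ h)))" for n h
    unfolding win_prob_minus_Z by (simp add: sum_negf algebra_simps)
  fix l assume l: "- 1 \<le> l" "l \<le> 0" "- drift (- l) \<le> 0"
    and ev: "\<And>e h. 0 < e \<Longrightarrow> eventually (\<lambda>n. l - e < - (Z n \<omega> $ h)) sequentially"
  have "eventually (\<lambda>n. Z n \<omega> $ h < - l + e) sequentially" if "0 < e" for e h
    using ev[OF that, of h] by eventually_elim simp
  then show thesis using that[of "- l"] l by simp
qed (use alpha in \<open>simp_all add: r_eventually_nonneg r_lim r_not_summable Z_range[OF w]\<close>)

text \<open>All lower limits are at least \<open>c\<close> and all upper limits at most
  \<open>c\<close>. Only \<open>below\<close> is restricted to arguments from \<open>lo\<close> on:
  for \<beta> = 0 the drift also vanishes at \<open>0\<close>, where \<open>below\<close> would fail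
  for a positive \<open>c\<close>.\<close>

lemma Z_tendsto:
  assumes w: "\<omega> \<in> space M" and conv: "\<And>h. convergent (\<lambda>n. noise \<omega> n h)"
    and lo: "0 \<le> lo" "eventually (\<lambda>n. \<forall>h. lo \<le> Z n \<omega> $ h) sequentially"
    and below: "\<And>x. lo \<le> x \<Longrightarrow> x \<le> 1 \<Longrightarrow> drift x \<le> 0 \<Longrightarrow> c \<le> x"
    and above: "\<And>x. 0 \<le> x \<Longrightarrow> x \<le> 1 \<Longrightarrow> 0 \<le> drift x \<Longrightarrow> x \<le> c"
  shows "(\<lambda>n. Z n \<omega> $ h) \<longlonglongrightarrow> c"
proof -
  obtain l where l: "lo \<le> l" "l \<le> 1" "drift l \<le> 0"
    and evl: "\<And>e h. 0 < e \<Longrightarrow> eventually (\<lambda>n. l - e < Z n \<omega> $ h) sequentially"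
    using Z_lower_limit[OF w conv lo] by blast
  obtain u where u: "0 \<le> u" "u \<le> 1" "0 \<le> drift u"
    and evu: "\<And>e h. 0 < e \<Longrightarrow> eventually (\<lambda>n. Z n \<omega> $ h < u + e) sequentially"
    using Z_upper_limit[OF w conv] by blast
  show ?thesis
  proof (rule order_tendstoI)
    fix a assume "a < c"
    then have "0 < l - a" using below[OF l] by simp
    from evl[OF this, of h] show "eventually (\<lambda>n. a < Z n \<omega> $ h) sequentially" by simp
  next
    fix a assume "c < a"
    then have "0 < a - u" using above[OF u] by simp
    from evu[OF this, of h] show "eventually (\<lambda>n. Z n \<omega> $ h < a) sequentially" by simp
  qed
qed

section \<open>The mean of the components, and lower bounds for single components derived from
  it\<close>

text \<open>By linearity this is the conditional expectation of \<open>comp_mean (I (Suc n))\<close>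
  given \<open>hist n\<close>.\<close>

definition mean_win_prob :: "nat \<Rightarrow> 'a \<Rightarrow> real" where
  "mean_win_prob n \<omega> = (\<Sum>h\<in>UNIV. win_prob n \<omega> h) / CARD('n)"

text \<open>Averaging the compensated components gives a scalar recursion that follows the mean and
  has increment \<open>mean_win_prob - comp_mean\<close>. Its sign matters only in the strip between
  \<open>a\<close> and \<open>b\<close>, which the mean can no longer cross downwards.\<close>

lemma comp_mean_eventually_ge:
  assumes w: "\<omega> \<in> space M" and conv: "\<And>h. convergent (\<lambda>n. noise \<omega> n h)"
    and "a < b"
    and drift: "\<And>n. a \<le> comp_mean (Z n \<omega>) \<Longrightarrow> comp_mean (Z n \<omega>) \<le> b \<Longrightarrow>
      comp_mean (Z n \<omega>) \<le> mean_win_prob n \<omega>"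
    and freq: "frequently (\<lambda>n. b < comp_mean (Z n \<omega>)) sequentially"
  shows "eventually (\<lambda>n. a \<le> comp_mean (Z n \<omega>)) sequentially"
proof (rule eventually_ge_if_frequently_gt[where y = "\<lambda>n. (\<Sum>h\<in>UNIV. compensated \<omega> n h) / CARD('n)"
      and r = r and d = "\<lambda>n. mean_win_prob n \<omega> - comp_mean (Z n \<omega>)" and C = 1 and b = b])
  have "(\<lambda>n. (\<Sum>h\<in>UNIV. compensated \<omega> n h - Z n \<omega> $ h) / CARD('n)) \<longlonglongrightarrow> (\<Sum>h\<in>(UNIV::'n set). 0) / CARD('n)"
    by (intro tendsto_intros compensated_close conv) auto
  then show "(\<lambda>n. (\<Sum>h\<in>UNIV. compensated \<omega> n h) / CARD('n) - comp_mean (Z n \<omega>)) \<longlonglongrightarrow> 0"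
    by (simp add: comp_mean_def sum_subtractf diff_divide_distrib)
  show "(\<Sum>h\<in>UNIV. compensated \<omega> (Suc n) h) / CARD('n) = (\<Sum>h\<in>UNIV. compensated \<omega> n h) / CARD('n)
      + r n * (mean_win_prob n \<omega> - comp_mean (Z n \<omega>))" for n
    by (simp add: compensated_step[OF w] comp_mean_def mean_win_prob_def sum.distrib
        sum_subtractf sum_distrib_left[symmetric] add_divide_distrib diff_divide_distrib right_diff_distrib)
  have "\<bar>\<Sum>h\<in>UNIV. win_prob n \<omega> h - Z n \<omega> $ h\<bar> \<le> (\<Sum>h\<in>(UNIV::'n set). 1)" for n
    by (rule order_trans[OF sum_abs sum_mono]) (rule win_prob_minus_Z_bound[OF w])
  then have "\<bar>\<Sum>h\<in>UNIV. win_prob n \<omega> h - Z n \<omega> $ h\<bar> / CARD('n) \<le> 1" for n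
    by (simp add: divide_le_eq_1)
  then show "\<bar>mean_win_prob n \<omega> - comp_mean (Z n \<omega>)\<bar> \<le> 1" for n
    by (simp add: mean_win_prob_def comp_mean_def sum_subtractf diff_divide_distrib[symmetric])
qed (use assms r_eventually_nonneg r_lim in auto)

text \<open>A component below \<open>min b (a / 2)\<close> has nonnegative own drift, and it is at
  least \<open>a / 2\<close> below the mean, so the interaction pulls it upwards at rate at least
  \<open>\<alpha> * (a / 2)\<close>.\<close>

lemma Z_eventually_ge_if_mean_ge:
  assumes w: "\<omega> \<in> space M" and conv: "\<And>h. convergent (\<lambda>n. noise \<omega> n h)"
    and "0 < \<alpha>" "0 < b" and drift: "\<And>x. 0 \<le> x \<Longrightarrow> x \<le> b \<Longrightarrow> 0 \<le> drift x"
    and "0 < a" and mean: "eventually (\<lambda>n. a \<le> comp_mean (Z n \<omega>)) sequentially"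
  obtains lo where "0 < lo" "eventually (\<lambda>n. \<forall>h. lo \<le> Z n \<omega> $ h) sequentially"
proof -
  define c where "c = min b (a / 2)"
  have c: "0 < c" "c \<le> b" "c \<le> a / 2" using assms by (auto simp: c_def)
  have "eventually (\<lambda>n. c / 2 \<le> Z n \<omega> $ h) sequentially" for h
  proof (rule eventually_ge_if_positive_drift[where y = "\<lambda>n. compensated \<omega> n h" and r = r
        and d = "\<lambda>n. win_prob n \<omega> h - Z n \<omega> $ h" and C = 1 and a = 0 and b = c
        and c = "\<alpha> * (a / 2)" and u = 1])
    show "eventually (\<lambda>n. 0 \<le> Z n \<omega> $ h \<and> Z n \<omega> $ h \<le> c \<longrightarrow>
        \<alpha> * (a / 2) \<le> win_prob n \<omega> h - Z n \<omega> $ h) sequentially"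
      using mean
    proof eventually_elim
      case (elim n)
      show ?case
      proof
        assume z: "0 \<le> Z n \<omega> $ h \<and> Z n \<omega> $ h \<le> c"
        have "\<alpha> * (a / 2) \<le> \<alpha> * (comp_mean (Z n \<omega>) - Z n \<omega> $ h)"
          using elim z c \<open>0 < \<alpha>\<close> by (intro mult_left_mono) auto
        then show "\<alpha> * (a / 2) \<le> win_prob n \<omega> h - Z n \<omega> $ h"
          using drift[of "Z n \<omega> $ h"] z c unfolding win_prob_minus_Z comp_mean_def by simp
      qed
    qed
  qed (use assms c in \<open>auto intro: compensated_close compensated_step[OF w] r_eventually_nonneg r_lim
      win_prob_minus_Z_bound[OF w] simp: r_not_summable Z_range[OF w]\<close>)
  then have "eventually (\<lambda>n. \<forall>h. c / 2 \<le> Z n \<omega> $ h) sequentially"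
    by (simp add: eventually_all_finite)
  then show ?thesis using that[of "c / 2"] c by simp
qed

end

subsection \<open>Exponential supermartingale near zero\<close>

lemma filterlim_sum_at_top_if_not_summable:
  fixes a :: "nat \<Rightarrow> real"
  assumes nonneg: "\<And>n. 0 \<le> a n" and "\<not> summable a"
  shows "filterlim (\<lambda>n. \<Sum>k<n. a k) at_top sequentially"
  unfolding filterlim_at_top
proof
  fix C
  have "\<exists>n. C \<le> (\<Sum>k<n. a k)"
  proof (rule ccontr)
    assume "\<not> ?thesis"
    then have "(\<Sum>k\<le>n. a k) \<le> C" for n
      by (metis lessThan_Suc_atMost linorder_le_cases)
    then show False using bounded_imp_summable[of a C] assms by auto
  qed
  then obtain n where n: "C \<le> (\<Sum>k<n. a k)" by blast
  have "C \<le> (\<Sum>k<m. a k)" if "n \<le> m" for m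
    using that by (intro order_trans[OF n] sum_mono2) (auto intro: nonneg)
  then show "eventually (\<lambda>n. C \<le> (\<Sum>k<n. a k)) sequentially"
    unfolding eventually_sequentially by blast
qed

text \<open>Convexity on the segment from \<open>0\<close> to \<open>- c\<close>. The bound is
  affine in \<open>s\<close>, so that after taking expectations only the conditional mean of
  \<open>s\<close> enters.\<close>

lemma exp_le_chord:
  fixes c s :: real
  assumes "0 \<le> s" "s \<le> 1"
  shows "exp (- (c * s)) \<le> 1 - s * (1 - exp (- c))"
  using convex_onD[OF exp_convex, of s 0 "- c"] assms by (simp add: algebra_simps)

lemma one_minus_exp_ge:
  fixes c :: real
  assumes "0 \<le> c"
  shows "c / (1 + c) \<le> 1 - exp (- c)"
proof -
  have "exp (- c) \<le> 1 / (1 + c)"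
    using exp_ge_add_one_self[of c] assms by (simp add: exp_minus field_simps)
  then show ?thesis using assms by (simp add: field_simps)
qed

context interacting_system
begin

lemma comp_mean_Z_bounds:
  assumes "\<omega> \<in> space M"
  shows "0 \<le> comp_mean (Z n \<omega>)" "comp_mean (Z n \<omega>) \<le> 1"
  using comp_mean_bounds[of "Z n \<omega>"] Z_range[OF assms] by auto

lemma comp_mean_I_bounds:
  assumes "\<omega> \<in> space M"
  shows "0 \<le> comp_mean (I (Suc n) \<omega>)" "comp_mean (I (Suc n) \<omega>) \<le> 1"
  using comp_mean_bounds[of "I (Suc n) \<omega>"] I_bounds[OF assms] by auto

lemma comp_mean_I_ge:
  assumes w: "\<omega> \<in> space M" and "comp_mean (I (Suc n) \<omega>) \<noteq> 0"
  shows "1 / CARD('n) \<le> comp_mean (I (Suc n) \<omega>)"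
proof -
  have "\<exists>h. I (Suc n) \<omega> $ h \<noteq> 0" using assms(2) unfolding comp_mean_def by (auto intro: ccontr)
  then obtain h where "I (Suc n) \<omega> $ h = 1" using I_range[OF w, of n] by auto
  then have "1 \<le> (\<Sum>i\<in>UNIV. I (Suc n) \<omega> $ i)"
    using member_le_sum[of h UNIV "\<lambda>i. I (Suc n) \<omega> $ i"] I_bounds[OF w, of n] by simp
  then show ?thesis unfolding comp_mean_def by (simp add: divide_right_mono)
qed

lemma comp_mean_Z_Suc:
  assumes "\<omega> \<in> space M"
  shows "comp_mean (Z (Suc n) \<omega>) = (1 - r n) * comp_mean (Z n \<omega>) + r n * comp_mean (I (Suc n) \<omega>)"
  by (simp add: comp_mean_def Z_Suc[OF assms] sum.distrib sum_distrib_left[symmetric] add_divide_distrib)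

lemma comp_mean_Z_measurable:
  "m \<le> n \<Longrightarrow> (\<lambda>\<omega>. comp_mean (Z m \<omega>)) \<in> borel_measurable (hist n)"
  using measurable_from_subalg[OF history_mono comp_mean_measurable_history] .

lemma comp_mean_I_measurable:
  assumes "m < n"
  shows "(\<lambda>\<omega>. comp_mean (I (Suc m) \<omega>)) \<in> borel_measurable (hist n)"
proof -
  have [measurable]: "(\<lambda>\<omega>. I (Suc m) \<omega> $ h) \<in> borel_measurable (hist n)" for h
    using assms by (intro I_measurable_history) auto
  show ?thesis unfolding comp_mean_def by measurable
qed

lemma hist_sets_mono: "A \<in> sets (hist m) \<Longrightarrow> m \<le> n \<Longrightarrow> A \<in> sets (hist n)"
  using history_mono[of m n] by (auto simp: subalgebra_def)

lemma hist_sets_events: "A \<in> sets (hist m) \<Longrightarrow> A \<in> events"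
  using subalgebra_history[of m] by (auto simp: subalgebra_def)

lemma
  fixes g :: "'a \<Rightarrow> real"
  assumes g: "g \<in> borel_measurable (hist n)" and B: "\<And>\<omega>. \<omega> \<in> space M \<Longrightarrow> \<bar>g \<omega>\<bar> \<le> B"
  shows integrable_mean_I_mult: "integrable M (\<lambda>\<omega>. comp_mean (I (Suc n) \<omega>) * g \<omega>)"
    and integrable_mean_win_prob_mult: "integrable M (\<lambda>\<omega>. mean_win_prob n \<omega> * g \<omega>)"
    and expectation_mean_I_mult: "expectation (\<lambda>\<omega>. comp_mean (I (Suc n) \<omega>) * g \<omega>) =
      expectation (\<lambda>\<omega>. mean_win_prob n \<omega> * g \<omega>)"
proof -
  have I_eq: "comp_mean (I (Suc n) \<omega>) * g \<omega> = (\<Sum>h\<in>UNIV. I (Suc n) \<omega> $ h * g \<omega>) / CARD('n)" for \<omega>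
    by (simp add: comp_mean_def sum_distrib_right)
  have p_eq: "mean_win_prob n \<omega> * g \<omega> = (\<Sum>h\<in>UNIV. win_prob n \<omega> h * g \<omega>) / CARD('n)" for \<omega>
    by (simp add: mean_win_prob_def sum_distrib_right)
  note int = integrable_I_mult[OF g B] integrable_win_prob_mult[OF g B]
  show "integrable M (\<lambda>\<omega>. comp_mean (I (Suc n) \<omega>) * g \<omega>)"
    unfolding I_eq using int by (intro integrable_divide integrable_sum) auto
  show "integrable M (\<lambda>\<omega>. mean_win_prob n \<omega> * g \<omega>)"
    unfolding p_eq using int by (intro integrable_divide integrable_sum) auto
  show "expectation (\<lambda>\<omega>. comp_mean (I (Suc n) \<omega>) * g \<omega>) = expectation (\<lambda>\<omega>. mean_win_prob n \<omega> * g \<omega>)"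
    unfolding I_eq p_eq using int by (simp add: expectation_I_mult[OF g B])
qed

text \<open>The successes are replaced by their conditional mean under the factor \<open>g\<close>.
  Since \<open>lower\<close> is asked for only where \<open>g\<close> does not vanish,
  \<open>g\<close> may carry the indicator of an event on which the mean is small.\<close>

lemma expectation_one_minus_mean_I_le:
  fixes g :: "'a \<Rightarrow> real"
  assumes g: "g \<in> borel_measurable (hist n)" and B: "\<And>\<omega>. \<omega> \<in> space M \<Longrightarrow> 0 \<le> g \<omega> \<and> g \<omega> \<le> B"
    and "0 \<le> c"
    and lower: "\<And>\<omega>. \<omega> \<in> space M \<Longrightarrow> g \<omega> \<noteq> 0 \<Longrightarrow>
      \<gamma> * comp_mean (Z n \<omega>) \<le> mean_win_prob n \<omega>"
  shows "expectation (\<lambda>\<omega>. (1 - c * comp_mean (I (Suc n) \<omega>)) * g \<omega>) \<le>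
    expectation (\<lambda>\<omega>. (1 - c * (\<gamma> * comp_mean (Z n \<omega>))) * g \<omega>)"
proof -
  have B': "\<bar>g \<omega>\<bar> \<le> B" if "\<omega> \<in> space M" for \<omega> using B[OF that] by simp
  have int_g: "integrable M g" using g B' by (rule integrable_bounded_history)
  note int = integrable_mean_I_mult[OF g B'] integrable_mean_win_prob_mult[OF g B']
  have int_Z: "integrable M (\<lambda>\<omega>. comp_mean (Z n \<omega>) * g \<omega>)"
  proof (rule integrable_bounded_history)
    show "(\<lambda>\<omega>. comp_mean (Z n \<omega>) * g \<omega>) \<in> borel_measurable (hist n)"
      using g comp_mean_measurable_history[of n] by measurable
    fix \<omega> assume w: "\<omega> \<in> space M"
    show "\<bar>comp_mean (Z n \<omega>) * g \<omega>\<bar> \<le> B"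
      using mult_mono[of "comp_mean (Z n \<omega>)" 1 "g \<omega>" B] comp_mean_Z_bounds[OF w, of n] B[OF w]
      by simp
  qed
  have "expectation (\<lambda>\<omega>. (1 - c * comp_mean (I (Suc n) \<omega>)) * g \<omega>)
      = expectation (\<lambda>\<omega>. g \<omega> - c * (comp_mean (I (Suc n) \<omega>) * g \<omega>))"
    by (simp add: algebra_simps)
  also have "\<dots> = expectation g - c * expectation (\<lambda>\<omega>. mean_win_prob n \<omega> * g \<omega>)"
    using int int_g expectation_mean_I_mult[OF g B'] by simp
  also have "\<dots> = expectation (\<lambda>\<omega>. g \<omega> - c * (mean_win_prob n \<omega> * g \<omega>))"
    using int int_g by simp
  also have "\<dots> \<le> expectation (\<lambda>\<omega>. g \<omega> - (c * \<gamma>) * (comp_mean (Z n \<omega>) * g \<omega>))"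
  proof (rule integral_mono)
    show "integrable M (\<lambda>\<omega>. g \<omega> - c * (mean_win_prob n \<omega> * g \<omega>))"
      using int int_g by auto
    show "integrable M (\<lambda>\<omega>. g \<omega> - (c * \<gamma>) * (comp_mean (Z n \<omega>) * g \<omega>))"
      using int_Z int_g by auto
    fix \<omega> assume w: "\<omega> \<in> space M"
    show "g \<omega> - c * (mean_win_prob n \<omega> * g \<omega>) \<le> g \<omega> - (c * \<gamma>) * (comp_mean (Z n \<omega>) * g \<omega>)"
    proof (cases "g \<omega> = 0")
      case False
      then have "c * (\<gamma> * comp_mean (Z n \<omega>) * g \<omega>) \<le> c * (mean_win_prob n \<omega> * g \<omega>)"
        using lower[OF w] B[OF w] \<open>0 \<le> c\<close> by (intro mult_left_mono mult_right_mono) auto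
      then show ?thesis by (simp add: mult.assoc)
    qed simp
  qed
  also have "\<dots> = expectation (\<lambda>\<omega>. (1 - c * (\<gamma> * comp_mean (Z n \<omega>))) * g \<omega>)"
    by (simp add: algebra_simps)
  finally show ?thesis .
qed

text \<open>The chord bound makes the factor with the new successes affine, their conditional mean
  is at least \<gamma> times the current mean, and \<open>1 - x \<le> exp (- x)\<close> restores an
  exponential. The collected exponent is the right-hand side of the condition on \<mu>.\<close>

lemma expectation_exp_step:
  assumes A: "A \<in> sets (hist n)"
    and lower: "\<And>\<omega>. \<omega> \<in> A \<Longrightarrow> \<gamma> * comp_mean (Z n \<omega>) \<le> mean_win_prob n \<omega>"
    and r: "0 \<le> r n" "r n \<le> 1" and "0 \<le> \<nu>"
    and \<mu>: "\<mu> \<le> \<nu> * (1 - r n) + \<gamma> * (1 - exp (- (\<nu> * r n)))"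
  shows "expectation (\<lambda>\<omega>. indicator A \<omega> * exp (- (\<nu> * comp_mean (Z (Suc n) \<omega>)))) \<le>
    expectation (\<lambda>\<omega>. indicator A \<omega> * exp (- (\<mu> * comp_mean (Z n \<omega>))))"
proof -
  define c where "c = 1 - exp (- (\<nu> * r n))"
  have c: "0 \<le> c" using r \<open>0 \<le> \<nu>\<close> by (simp add: c_def)
  define g where "g \<omega> = indicator A \<omega> * exp (- (\<nu> * (1 - r n) * comp_mean (Z n \<omega>)))" for \<omega>
  note [measurable] = A comp_mean_measurable_history[of n]
  have g: "g \<in> borel_measurable (hist n)" unfolding g_def by measurable
  have g_bounds: "0 \<le> g \<omega> \<and> g \<omega> \<le> 1" if "\<omega> \<in> space M" for \<omega>
    using r \<open>0 \<le> \<nu>\<close> comp_mean_Z_bounds[OF that, of n]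
    by (auto simp: g_def indicator_def)
  have "expectation (\<lambda>\<omega>. indicator A \<omega> * exp (- (\<nu> * comp_mean (Z (Suc n) \<omega>))))
      \<le> expectation (\<lambda>\<omega>. (1 - c * comp_mean (I (Suc n) \<omega>)) * g \<omega>)"
  proof (rule integral_mono)
    show "integrable M (\<lambda>\<omega>. indicator A \<omega> * exp (- (\<nu> * comp_mean (Z (Suc n) \<omega>))))"
    proof (rule integrable_bounded_history[where n = "Suc n" and B = 1])
      show "(\<lambda>\<omega>. indicator A \<omega> * exp (- (\<nu> * comp_mean (Z (Suc n) \<omega>)))) \<in> borel_measurable (hist (Suc n))"
        using hist_sets_mono[OF A, of "Suc n"] comp_mean_measurable_history[of "Suc n"] by measurable
      show "\<bar>indicator A \<omega> * exp (- (\<nu> * comp_mean (Z (Suc n) \<omega>)))\<bar> \<le> 1" if "\<omega> \<in> space M" for \<omega>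
        using comp_mean_Z_bounds[OF that, of "Suc n"] \<open>0 \<le> \<nu>\<close> by (auto simp: indicator_def)
    qed
    have "integrable M (\<lambda>\<omega>. g \<omega> - c * (comp_mean (I (Suc n) \<omega>) * g \<omega>))"
      using integrable_mean_I_mult[OF g, of 1] integrable_bounded_history[OF g, of 1] g_bounds by simp
    then show "integrable M (\<lambda>\<omega>. (1 - c * comp_mean (I (Suc n) \<omega>)) * g \<omega>)"
      by (simp add: algebra_simps)
    fix \<omega> assume w: "\<omega> \<in> space M"
    have "exp (- (\<nu> * comp_mean (Z (Suc n) \<omega>)))
        = exp (- (\<nu> * r n * comp_mean (I (Suc n) \<omega>))) * exp (- (\<nu> * (1 - r n) * comp_mean (Z n \<omega>)))"
      unfolding comp_mean_Z_Suc[OF w] by (simp add: exp_add[symmetric] algebra_simps)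
    also have "\<dots> \<le> (1 - c * comp_mean (I (Suc n) \<omega>)) * exp (- (\<nu> * (1 - r n) * comp_mean (Z n \<omega>)))"
      using exp_le_chord[OF comp_mean_I_bounds[OF w], of "\<nu> * r n" n]
      by (intro mult_right_mono) (auto simp: c_def mult.commute)
    finally show "indicator A \<omega> * exp (- (\<nu> * comp_mean (Z (Suc n) \<omega>)))
        \<le> (1 - c * comp_mean (I (Suc n) \<omega>)) * g \<omega>"
      by (auto simp: g_def indicator_def)
  qed
  also have "\<dots> \<le> expectation (\<lambda>\<omega>. (1 - c * (\<gamma> * comp_mean (Z n \<omega>))) * g \<omega>)"
    using g g_bounds c
  proof (rule expectation_one_minus_mean_I_le)
    show "\<gamma> * comp_mean (Z n \<omega>) \<le> mean_win_prob n \<omega>" if "g \<omega> \<noteq> 0" for \<omega>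
      using that lower[of \<omega>] by (auto simp: g_def indicator_def split: if_splits)
  qed
  also have "\<dots> \<le> expectation (\<lambda>\<omega>. indicator A \<omega> * exp (- (\<mu> * comp_mean (Z n \<omega>))))"
  proof (rule integral_mono)
    have "\<bar>c * \<gamma> * comp_mean (Z n \<omega>) * g \<omega>\<bar> \<le> \<bar>c * \<gamma>\<bar>" if w: "\<omega> \<in> space M" for \<omega>
    proof -
      have "\<bar>comp_mean (Z n \<omega>) * g \<omega>\<bar> \<le> 1"
        using comp_mean_Z_bounds[OF w, of n] g_bounds[OF w] by (simp add: abs_mult mult_le_one)
      then show ?thesis
        using mult_left_mono[of "\<bar>comp_mean (Z n \<omega>) * g \<omega>\<bar>" 1 "\<bar>c * \<gamma>\<bar>"] by (simp add: abs_mult mult.assoc)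
    qed
    then have "integrable M (\<lambda>\<omega>. c * \<gamma> * comp_mean (Z n \<omega>) * g \<omega>)"
      by (rule integrable_bounded_history[rotated]) (use g in measurable)
    moreover have "integrable M g" using integrable_bounded_history[OF g, of 1] g_bounds by simp
    ultimately have "integrable M (\<lambda>\<omega>. g \<omega> - c * \<gamma> * comp_mean (Z n \<omega>) * g \<omega>)" by simp
    then show "integrable M (\<lambda>\<omega>. (1 - c * (\<gamma> * comp_mean (Z n \<omega>))) * g \<omega>)"
      by (simp add: algebra_simps)
    show "integrable M (\<lambda>\<omega>. indicator A \<omega> * exp (- (\<mu> * comp_mean (Z n \<omega>))))"
    proof (rule integrable_bounded_history[where n = n and B = "exp \<bar>\<mu>\<bar>"])
      fix \<omega> assume w: "\<omega> \<in> space M"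
      have "\<bar>\<mu> * comp_mean (Z n \<omega>)\<bar> \<le> \<bar>\<mu>\<bar>"
        using comp_mean_Z_bounds[OF w, of n] by (simp add: abs_mult mult_left_le)
      then show "\<bar>indicator A \<omega> * exp (- (\<mu> * comp_mean (Z n \<omega>)))\<bar> \<le> exp \<bar>\<mu>\<bar>"
        by (auto simp: indicator_def)
    qed measurable
    fix \<omega> assume w: "\<omega> \<in> space M"
    show "(1 - c * (\<gamma> * comp_mean (Z n \<omega>))) * g \<omega> \<le> indicator A \<omega> * exp (- (\<mu> * comp_mean (Z n \<omega>)))"
    proof (cases "\<omega> \<in> A")
      case True
      have "1 - c * (\<gamma> * comp_mean (Z n \<omega>)) \<le> exp (- (c * (\<gamma> * comp_mean (Z n \<omega>))))"
        using exp_ge_add_one_self[of "- (c * (\<gamma> * comp_mean (Z n \<omega>)))"] by simp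
      then have "(1 - c * (\<gamma> * comp_mean (Z n \<omega>))) * g \<omega> \<le>
          exp (- (c * (\<gamma> * comp_mean (Z n \<omega>)))) * g \<omega>"
        using g_bounds[OF w] by (intro mult_right_mono) auto
      also have "\<dots> = exp (- ((\<nu> * (1 - r n) + \<gamma> * c) * comp_mean (Z n \<omega>)))"
        using True by (simp add: g_def exp_add[symmetric] algebra_simps)
      also have "\<dots> \<le> exp (- (\<mu> * comp_mean (Z n \<omega>)))"
        using \<mu> comp_mean_Z_bounds[OF w, of n] by (simp add: c_def mult_right_mono)
      finally show ?thesis using True by simp
    qed (simp add: g_def)
  qed
  finally show ?thesis .
qed

lemma mean_Z_le_set: "{\<omega> \<in> space M. comp_mean (Z n \<omega>) \<le> \<epsilon>} \<in> sets (hist n)"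
proof -
  have "{\<omega> \<in> space (hist n). comp_mean (Z n \<omega>) \<le> \<epsilon>} \<in> sets (hist n)"
    using comp_mean_measurable_history[of n] by measurable
  then show ?thesis by simp
qed

lemma mean_I_eq_0_set: "{\<omega> \<in> space M. comp_mean (I (Suc n) \<omega>) = 0} \<in> sets (hist (Suc n))"
proof -
  have "{\<omega> \<in> space (hist (Suc n)). comp_mean (I (Suc n) \<omega>) = 0} \<in> sets (hist (Suc n))"
    using comp_mean_I_measurable[of n "Suc n"] by measurable
  then show ?thesis by simp
qed

lemma stays_small_set_measurable:
  "{\<omega> \<in> space M. \<forall>n\<ge>k. comp_mean (Z n \<omega>) \<le> \<epsilon>} \<in> events"
proof -
  have [measurable]: "(\<lambda>\<omega>. comp_mean (Z n \<omega>)) \<in> borel_measurable M" for n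
    using measurable_from_subalg[OF subalgebra_history comp_mean_measurable_history] .
  show ?thesis by measurable
qed

text \<open>While the mean stays below \<open>\<epsilon>\<close>, \<open>exp (- \<mu> n * comp_mean (Z n))\<close> is a supermartingale for
  weights with \<open>\<mu> (Suc n) * (1 + s * r n) = \<mu> n\<close>; as these tend to \<open>0\<close>, it would tend to \<open>1\<close>.\<close>

lemma prob_stays_small_le:
  assumes \<gamma>: "1 < \<gamma>"
    and lower: "\<And>n \<omega>. \<omega> \<in> space M \<Longrightarrow> comp_mean (Z n \<omega>) \<le> \<epsilon> \<Longrightarrow>
      \<gamma> * comp_mean (Z n \<omega>) \<le> mean_win_prob n \<omega>"
    and r01: "\<And>n. 0 \<le> r n \<and> r n < 1"
  obtains c m where "0 < c" and
    "\<And>k A. m \<le> k \<Longrightarrow> A \<in> sets (hist k) \<Longrightarrow>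
      prob (A \<inter> {\<omega> \<in> space M. \<forall>n\<ge>k. comp_mean (Z n \<omega>) \<le> \<epsilon>}) \<le>
      expectation (\<lambda>\<omega>. indicator A \<omega> * exp (- (c * real k * comp_mean (Z k \<omega>))))"
proof -
  \<comment> \<open>A growth factor strictly between \<open>1\<close> and \<gamma>. The gap pays for
    replacing \<open>1 - exp (- x)\<close> by \<open>x\<close>, which is possible up to
    \<open>d\<close>, the solution of \<open>\<gamma>' * (1 + d) = \<gamma>\<close>.\<close>
  define \<gamma>' where "\<gamma>' = (1 + \<gamma>) / 2"
  define s where "s = \<gamma>' - 1"
  define d where "d = \<gamma> / \<gamma>' - 1"
  have \<gamma>': "1 < \<gamma>'" "\<gamma>' < \<gamma>" using \<gamma> by (auto simp: \<gamma>'_def)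
  then have s: "0 < s" and d: "0 < d" by (auto simp: s_def d_def)
  \<comment> \<open>Weights up to \<open>c * real k\<close> and steps up to
    \<open>2 / real k\<close> have products at most \<open>d\<close>, the range in which
    \<open>slope\<close> applies.\<close>
  define c where "c = d / 2"
  have c: "0 < c" using d by (simp add: c_def)
  have slope: "\<gamma>' * x \<le> \<gamma> * (1 - exp (- x))" if "0 \<le> x" "x \<le> d" for x
  proof -
    have "\<gamma>' * (1 + x) \<le> \<gamma>' * (1 + d)" using that \<gamma>' by (intro mult_left_mono) auto
    also have "\<dots> = \<gamma>" using \<gamma>' by (simp add: d_def)
    finally have "\<gamma>' * (1 + x) * x \<le> \<gamma> * x" using that by (intro mult_right_mono) auto
    then have "\<gamma>' * x \<le> \<gamma> * (x / (1 + x))" using that by (simp add: field_simps)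
    also have "\<dots> \<le> \<gamma> * (1 - exp (- x))"
      using one_minus_exp_ge[OF that(1)] \<gamma> by (intro mult_left_mono) auto
    finally show ?thesis .
  qed
  obtain m where m: "\<And>n. n \<ge> m \<Longrightarrow> 0 < n \<and> 1 / (2 * real n) \<le> r n \<and> r n \<le> 2 / real n"
    using r_eventually_bounds unfolding eventually_sequentially by blast
  have "prob (A \<inter> {\<omega> \<in> space M. \<forall>n\<ge>k. comp_mean (Z n \<omega>) \<le> \<epsilon>}) \<le>
      expectation (\<lambda>\<omega>. indicator A \<omega> * exp (- (c * real k * comp_mean (Z k \<omega>))))"
    if k: "m \<le> k" and A: "A \<in> sets (hist k)" for k A
  proof -
    \<comment> \<open>The initial weight is of order \<open>k\<close> to match a mean of order
      \<open>1 / k\<close>; the denominator solves the recursion for the weights, with time counted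
      from \<open>k\<close>.\<close>
    define \<mu> where "\<mu> i = c * real k / (\<Prod>l<i. 1 + s * r (l + k))" for i
    define D where "D i = {\<omega> \<in> A. \<forall>l\<le>i. comp_mean (Z (l + k) \<omega>) \<le> \<epsilon>}" for i
    define V where "V i = expectation (\<lambda>\<omega>. indicator (D i) \<omega> * exp (- (\<mu> i * comp_mean (Z (i + k) \<omega>))))" for i
    define E where "E = {\<omega> \<in> space M. \<forall>n\<ge>k. comp_mean (Z n \<omega>) \<le> \<epsilon>}"
    have A_sub: "A \<subseteq> space M" using sets.sets_into_space[OF A] by simp
    have prod_ge: "1 \<le> (\<Prod>l<i. 1 + s * r (l + k))" for i
      using s r01 by (intro prod_ge_1) (simp add: mult_nonneg_nonneg)
    have \<mu>_nonneg: "0 \<le> \<mu> i" for i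
      unfolding \<mu>_def using c order_trans[OF zero_le_one prod_ge[of i]] by simp
    have \<mu>_le: "\<mu> i \<le> c * real k" for i
      unfolding \<mu>_def using c prod_ge[of i]
      by (subst pos_divide_le_eq) (auto simp: mult_left_mono[of 1 _ "c * real k", simplified])
    have \<mu>_Suc: "\<mu> i = \<mu> (Suc i) * (1 + s * r (i + k))" for i
    proof -
      have "0 \<le> s * r (i + k)" using s r01 by simp
      then have "1 + s * r (i + k) \<noteq> 0" by linarith
      then show ?thesis by (simp add: \<mu>_def)
    qed
    have \<mu>_lim: "\<mu> \<longlonglongrightarrow> 0"
    proof -
      have "\<not> summable (\<lambda>l. r (l + k))" using r_not_summable summable_iff_shift by blast
      then have "\<not> summable (\<lambda>l. s * r (l + k))" using s by (simp add: summable_cmult_iff)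
      then have "filterlim (\<lambda>i. \<Sum>l<i. s * r (l + k)) at_top sequentially"
        using s r01 by (intro filterlim_sum_at_top_if_not_summable) auto
      then have "filterlim (\<lambda>i. \<Prod>l<i. 1 + s * r (l + k)) at_top sequentially"
        by (rule filterlim_at_top_mono)
           (use s r01 in \<open>auto intro!: always_eventually sum_le_prod\<close>)
      then show ?thesis
        unfolding \<mu>_def by (intro real_tendsto_divide_at_top[OF tendsto_const])
    qed
    have D_meas: "D i \<in> sets (hist (i + k))" for i
    proof (induction i)
      case 0
      have "D 0 = A \<inter> {\<omega> \<in> space M. comp_mean (Z k \<omega>) \<le> \<epsilon>}"
        using A_sub by (auto simp: D_def)
      then show ?case using A mean_Z_le_set[of k] by auto
    next
      case (Suc i)
      have "D (Suc i) = D i \<inter> {\<omega> \<in> space M. comp_mean (Z (Suc (i + k)) \<omega>) \<le> \<epsilon>}"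
        using A_sub by (auto simp: D_def le_Suc_eq)
      then show ?case
        using hist_sets_mono[OF Suc, of "Suc (i + k)"] mean_Z_le_set[of "Suc (i + k)"] by auto
    qed
    have int: "integrable M (\<lambda>\<omega>. indicator B \<omega> * exp (- (x * comp_mean (Z n \<omega>))))"
      if "B \<in> sets (hist n)" "0 \<le> x" for B x n
    proof (rule integrable_bounded_history[where n = n and B = 1])
      show "(\<lambda>\<omega>. indicator B \<omega> * exp (- (x * comp_mean (Z n \<omega>)))) \<in> borel_measurable (hist n)"
        using that(1) comp_mean_measurable_history[of n] by measurable
      show "\<bar>indicator B \<omega> * exp (- (x * comp_mean (Z n \<omega>)))\<bar> \<le> 1" if "\<omega> \<in> space M" for \<omega>
        using comp_mean_Z_bounds[OF that, of n] \<open>0 \<le> x\<close> by (auto simp: indicator_def)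
    qed
    have V_Suc: "V (Suc i) \<le> V i" for i
    proof -
      have "V (Suc i) \<le> expectation (\<lambda>\<omega>. indicator (D i) \<omega> *
          exp (- (\<mu> (Suc i) * comp_mean (Z (Suc (i + k)) \<omega>))))"
        unfolding V_def
      proof (rule integral_mono)
        show "integrable M (\<lambda>\<omega>. indicator (D (Suc i)) \<omega> * exp (- (\<mu> (Suc i) * comp_mean (Z (Suc i + k) \<omega>))))"
          using int[OF D_meas[of "Suc i"] \<mu>_nonneg] .
        show "integrable M (\<lambda>\<omega>. indicator (D i) \<omega> * exp (- (\<mu> (Suc i) * comp_mean (Z (Suc (i + k)) \<omega>))))"
          using int[OF hist_sets_mono[OF D_meas[of i], of "Suc (i + k)"] \<mu>_nonneg] by simp
      qed (auto simp: D_def indicator_def)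
      also have "\<dots> \<le> V i"
        unfolding V_def
      proof (rule expectation_exp_step[OF D_meas])
        show "\<gamma> * comp_mean (Z (i + k) \<omega>) \<le> mean_win_prob (i + k) \<omega>" if "\<omega> \<in> D i" for \<omega>
          using that A_sub by (intro lower) (auto simp: D_def)
        have "\<mu> (Suc i) * r (i + k) \<le> c * real k * (2 / real k)"
        proof (rule mult_mono[OF \<mu>_le])
          have "r (i + k) \<le> 2 / real (i + k)" using m[of "i + k"] k by simp
          also have "\<dots> \<le> 2 / real k" using m[of k] k by (intro divide_left_mono) auto
          finally show "r (i + k) \<le> 2 / real k" .
        qed (use c r01 in auto)
        also have "\<dots> = d" using m[OF k] by (simp add: c_def)
        finally have "\<gamma>' * (\<mu> (Suc i) * r (i + k)) \<le> \<gamma> * (1 - exp (- (\<mu> (Suc i) * r (i + k))))"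
          using r01 \<mu>_nonneg by (intro slope) auto
        \<comment> \<open>As \<open>s = \<gamma>' - 1\<close>, the factor
          \<open>1 + s * r (i + k)\<close> equals
          \<open>1 - r (i + k) + \<gamma>' * r (i + k)\<close>: shrinkage of the old mean plus
          growth through successes.\<close>
        then show "\<mu> i \<le> \<mu> (Suc i) * (1 - r (i + k)) + \<gamma> * (1 - exp (- (\<mu> (Suc i) * r (i + k))))"
          unfolding \<mu>_Suc[of i] s_def by (simp add: algebra_simps)
      qed (use r01 \<mu>_nonneg in \<open>auto intro: less_imp_le\<close>)
      finally show ?thesis .
    qed
    have V_le: "V i \<le> V 0" for i
      by (induction i) (auto intro: order_trans[OF V_Suc])
    have V_0: "V 0 \<le> expectation (\<lambda>\<omega>. indicator A \<omega> * exp (- (c * real k * comp_mean (Z k \<omega>))))"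
      unfolding V_def
    proof (rule integral_mono)
      show "integrable M (\<lambda>\<omega>. indicator (D 0) \<omega> * exp (- (\<mu> 0 * comp_mean (Z (0 + k) \<omega>))))"
        using int[OF D_meas[of 0] \<mu>_nonneg] .
      show "integrable M (\<lambda>\<omega>. indicator A \<omega> * exp (- (c * real k * comp_mean (Z k \<omega>))))"
        using int[OF A] c by simp
    qed (auto simp: D_def indicator_def \<mu>_def)
    have AE_meas: "A \<inter> E \<in> events"
      unfolding E_def by (intro sets.Int hist_sets_events[OF A] stays_small_set_measurable)
    \<comment> \<open>On \<open>A \<inter> E\<close> the mean never exceeds \<epsilon>, so the
      integrand of \<open>V i\<close> is at least \<open>exp (- (\<mu> i * \<epsilon>))\<close>,
      which tends to \<open>1\<close>.\<close>
    have "exp (- (\<mu> i * \<epsilon>)) * prob (A \<inter> E) \<le> V 0" for i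
    proof -
      have "exp (- (\<mu> i * \<epsilon>)) * prob (A \<inter> E) =
          expectation (\<lambda>\<omega>. exp (- (\<mu> i * \<epsilon>)) * indicator (A \<inter> E) \<omega>)"
        using AE_meas by simp
      also have "\<dots> \<le> V i"
        unfolding V_def
      proof (rule integral_mono)
        show "integrable M (\<lambda>\<omega>. exp (- (\<mu> i * \<epsilon>)) * indicator (A \<inter> E) \<omega>)"
          using AE_meas by (auto simp: emeasure_eq_measure)
        show "integrable M (\<lambda>\<omega>. indicator (D i) \<omega> * exp (- (\<mu> i * comp_mean (Z (i + k) \<omega>))))"
          using int[OF D_meas \<mu>_nonneg] .
        show "exp (- (\<mu> i * \<epsilon>)) * indicator (A \<inter> E) \<omega> \<le>
            indicator (D i) \<omega> * exp (- (\<mu> i * comp_mean (Z (i + k) \<omega>)))" for \<omega>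
          using \<mu>_nonneg[of i] by (auto simp: D_def E_def indicator_def intro!: mult_left_mono)
      qed
      finally show ?thesis using V_le[of i] by linarith
    qed
    moreover have "(\<lambda>i. exp (- (\<mu> i * \<epsilon>)) * prob (A \<inter> E)) \<longlonglongrightarrow> exp (- (0 * \<epsilon>)) * prob (A \<inter> E)"
      by (intro tendsto_intros \<mu>_lim)
    ultimately have "exp (- (0 * \<epsilon>)) * prob (A \<inter> E) \<le> V 0"
      by (intro LIMSEQ_le_const2) auto
    then show ?thesis using V_0 by (simp add: E_def)
  qed
  then show ?thesis using that[OF c] by blast
qed

section \<open>Recurrence of successes and escape from a neighbourhood of zero\<close>

text \<open>Without any success the mean shrinks exactly by these factors, and successes only
  increase it. This gives a deterministic floor for the success probability.\<close>

lemma comp_mean_Z_ge_prod: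
  assumes w: "\<omega> \<in> space M" and r01: "\<And>n. 0 \<le> r n \<and> r n < 1"
  shows "(\<Prod>k<n. 1 - r k) * comp_mean (Z 0 \<omega>) \<le> comp_mean (Z n \<omega>)"
proof (induction n)
  case (Suc n)
  have "(1 - r n) * ((\<Prod>k<n. 1 - r k) * comp_mean (Z 0 \<omega>)) \<le> (1 - r n) * comp_mean (Z n \<omega>)"
    using Suc r01[of n] by (intro mult_left_mono) auto
  also have "\<dots> \<le> comp_mean (Z (Suc n) \<omega>)"
    using comp_mean_Z_Suc[OF w] comp_mean_I_bounds[OF w] r01[of n] by simp
  finally show ?case by (simp add: mult_ac)
qed simp

text \<open>Given the past, the next step is without success with probability at most
  \<open>1 - mean_win_prob\<close>. While the mean is small this is at most
  \<open>1 - \<delta> * P\<close> for the product \<open>P\<close> of the factors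
  \<open>1 - r k\<close>, hence at most \<open>exp (- (\<delta> * P))\<close>. The exponents add up
  to a divergent series.\<close>

lemma prob_no_success_tendsto_zero:
  assumes lower: "\<And>n \<omega>. \<omega> \<in> space M \<Longrightarrow> comp_mean (Z n \<omega>) \<le> \<epsilon> \<Longrightarrow>
      comp_mean (Z n \<omega>) \<le> mean_win_prob n \<omega>"
    and r01: "\<And>n. 0 \<le> r n \<and> r n < 1"
    and r_prod: "\<not> summable (\<lambda>n. \<Prod>k<n. 1 - r k)"
    and "0 < \<delta>" and A: "A \<in> sets (hist j)"
    and A_ge: "\<And>\<omega>. \<omega> \<in> A \<Longrightarrow> \<delta> \<le> comp_mean (Z 0 \<omega>)"
  shows "(\<lambda>i. prob {\<omega> \<in> A. \<forall>l<i. comp_mean (Z (l + j) \<omega>) \<le> \<epsilon> \<and> comp_mean (I (Suc (l + j)) \<omega>) = 0})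
    \<longlonglongrightarrow> 0"
proof -
  define D where "D i = {\<omega> \<in> A. \<forall>l<i. comp_mean (Z (l + j) \<omega>) \<le> \<epsilon> \<and> comp_mean (I (Suc (l + j)) \<omega>) = 0}" for i
  define P where "P n = (\<Prod>k<n. 1 - r k)" for n
  have A_sub: "A \<subseteq> space M" using sets.sets_into_space[OF A] by simp
  have P_nonneg: "0 \<le> P n" for n
    unfolding P_def using r01 by (intro prod_nonneg) (auto intro: less_imp_le)
  have D_Suc: "D (Suc i) = D i \<inter> {\<omega> \<in> space M. comp_mean (Z (i + j) \<omega>) \<le> \<epsilon>} \<inter>
      {\<omega> \<in> space M. comp_mean (I (Suc (i + j)) \<omega>) = 0}" for i
    using A_sub by (auto simp: D_def less_Suc_eq)
  have D_meas: "D i \<in> sets (hist (i + j))" for i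
  proof (induction i)
    case 0
    then show ?case using A by (simp add: D_def)
  next
    case (Suc i)
    show ?case
      unfolding D_Suc add_Suc
      by (intro sets.Int mean_I_eq_0_set hist_sets_mono[OF Suc] hist_sets_mono[OF mean_Z_le_set]) auto
  qed
  have step: "prob (D (Suc i)) \<le> exp (- (\<delta> * P (i + j))) * prob (D i)" for i
  proof -
    define B where "B = D i \<inter> {\<omega> \<in> space M. comp_mean (Z (i + j) \<omega>) \<le> \<epsilon>}"
    have B: "B \<in> sets (hist (i + j))" unfolding B_def by (intro sets.Int D_meas mean_Z_le_set)
    then have g: "indicator B \<in> borel_measurable (hist (i + j))" by measurable
    have "prob (D (Suc i)) = expectation (indicator (D (Suc i)))"
      using hist_sets_events[OF D_meas] by simp
    \<comment> \<open>The indicator of no success is bounded by the affine expression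
      \<open>1 - comp_mean I\<close>; the factor \<open>1\<close> fits it to
      \<open>expectation_one_minus_mean_I_le\<close>.\<close>
    also have "\<dots> \<le> expectation (\<lambda>\<omega>. (1 - 1 * comp_mean (I (Suc (i + j)) \<omega>)) * indicator B \<omega>)"
    proof (rule integral_mono)
      show "integrable M (indicator (D (Suc i)) :: _ \<Rightarrow> real)"
        using hist_sets_events[OF D_meas[of "Suc i"]] by (auto simp: emeasure_eq_measure)
      have "integrable M (\<lambda>\<omega>. indicator B \<omega> - comp_mean (I (Suc (i + j)) \<omega>) * indicator B \<omega> :: real)"
        by (intro Bochner_Integration.integrable_diff integrable_mean_I_mult[OF g, of 1]
            integrable_bounded_history[OF g, of 1]) auto
      then show "integrable M (\<lambda>\<omega>. (1 - 1 * comp_mean (I (Suc (i + j)) \<omega>)) * indicator B \<omega>)"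
        by (simp add: algebra_simps)
      show "indicator (D (Suc i)) \<omega> \<le> (1 - 1 * comp_mean (I (Suc (i + j)) \<omega>)) * indicator B \<omega>"
        if "\<omega> \<in> space M" for \<omega>
        using comp_mean_I_bounds[OF that, of "i + j"] unfolding D_Suc B_def[symmetric]
        by (auto simp: indicator_def)
    qed
    also have "\<dots> \<le> expectation (\<lambda>\<omega>. (1 - 1 * (1 * comp_mean (Z (i + j) \<omega>))) * indicator B \<omega>)"
      using g by (rule expectation_one_minus_mean_I_le[where B = 1])
         (use lower in \<open>auto simp: indicator_def B_def split: if_splits\<close>)
    also have "\<dots> \<le> expectation (\<lambda>\<omega>. exp (- (\<delta> * P (i + j))) * indicator (D i) \<omega>)"
    proof (rule integral_mono)
      show "integrable M (\<lambda>\<omega>. (1 - 1 * (1 * comp_mean (Z (i + j) \<omega>))) * indicator B \<omega>)"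
      proof (rule integrable_bounded_history[where n = "i + j" and B = 1])
        show "(\<lambda>\<omega>. (1 - 1 * (1 * comp_mean (Z (i + j) \<omega>))) * indicator B \<omega>) \<in> borel_measurable (hist (i + j))"
          using g comp_mean_measurable_history[of "i + j"] by measurable
        show "\<bar>(1 - 1 * (1 * comp_mean (Z (i + j) \<omega>))) * indicator B \<omega>\<bar> \<le> 1" if "\<omega> \<in> space M" for \<omega>
          using comp_mean_Z_bounds[OF that, of "i + j"] by (auto simp: indicator_def)
      qed
      show "integrable M (\<lambda>\<omega>. exp (- (\<delta> * P (i + j))) * indicator (D i) \<omega>)"
        using hist_sets_events[OF D_meas[of i]] by (auto simp: emeasure_eq_measure)
      fix \<omega> assume w: "\<omega> \<in> space M"
      show "(1 - 1 * (1 * comp_mean (Z (i + j) \<omega>))) * indicator B \<omega> \<le>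
          exp (- (\<delta> * P (i + j))) * indicator (D i) \<omega>"
      proof (cases "\<omega> \<in> B")
        case True
        then have "\<omega> \<in> D i" "\<omega> \<in> A" by (auto simp: B_def D_def)
        have "\<delta> * P (i + j) \<le> comp_mean (Z 0 \<omega>) * P (i + j)"
          using A_ge[OF \<open>\<omega> \<in> A\<close>] P_nonneg by (intro mult_right_mono)
        also have "\<dots> \<le> comp_mean (Z (i + j) \<omega>)"
          using comp_mean_Z_ge_prod[OF w r01] by (simp add: P_def mult.commute)
        finally have "1 - comp_mean (Z (i + j) \<omega>) \<le> 1 + - (\<delta> * P (i + j))" by simp
        also have "\<dots> \<le> exp (- (\<delta> * P (i + j)))" by (rule exp_ge_add_one_self)
        finally show ?thesis using True \<open>\<omega> \<in> D i\<close> by simp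
      qed simp
    qed
    also have "\<dots> = exp (- (\<delta> * P (i + j))) * prob (D i)"
      using hist_sets_events[OF D_meas[of i]] by simp
    finally show ?thesis .
  qed
  have bound: "prob (D i) \<le> exp (- (\<Sum>l<i. \<delta> * P (l + j)))" for i
  proof (induction i)
    case (Suc i)
    have "prob (D (Suc i)) \<le> exp (- (\<delta> * P (i + j))) * exp (- (\<Sum>l<i. \<delta> * P (l + j)))"
      using Suc by (intro order_trans[OF step] mult_left_mono) auto
    then show ?case by (simp add: exp_add[symmetric] add.commute algebra_simps)
  qed simp
  have "\<not> summable P" using r_prod by (simp add: P_def[abs_def])
  then have "\<not> summable (\<lambda>l. P (l + j))" by (simp only: summable_iff_shift not_False_eq_True)
  then have "\<not> summable (\<lambda>l. \<delta> * P (l + j))" using \<open>0 < \<delta>\<close> by (simp add: summable_cmult_iff)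
  then have "filterlim (\<lambda>i. \<Sum>l<i. \<delta> * P (l + j)) at_top sequentially"
    using \<open>0 < \<delta>\<close> P_nonneg by (intro filterlim_sum_at_top_if_not_summable) auto
  then have "(\<lambda>i. exp (- (\<Sum>l<i. \<delta> * P (l + j)))) \<longlonglongrightarrow> 0"
    by (intro filterlim_compose[OF exp_at_bot] filterlim_compose[OF filterlim_uminus_at_bot_at_top])
  then have "(\<lambda>i. prob (D i)) \<longlonglongrightarrow> 0"
    by (rule tendsto_sandwich[OF _ _ tendsto_const, rotated 2]) (use bound in auto)
  then show ?thesis unfolding D_def .
qed

text \<open>The estimate of \<open>prob_stays_small_le\<close> is applied at the first success after time \<open>j\<close>, where
  \<open>real k * comp_mean (Z k)\<close> is bounded away from \<open>0\<close>.\<close>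

lemma prob_stays_small_contraction:
  assumes \<gamma>: "1 < \<gamma>"
    and lower: "\<And>n \<omega>. \<omega> \<in> space M \<Longrightarrow> comp_mean (Z n \<omega>) \<le> \<epsilon> \<Longrightarrow>
      \<gamma> * comp_mean (Z n \<omega>) \<le> mean_win_prob n \<omega>"
    and r01: "\<And>n. 0 \<le> r n \<and> r n < 1"
    and r_prod: "\<not> summable (\<lambda>n. \<Prod>k<n. 1 - r k)"
    and \<delta>: "0 < \<delta>"
  obtains \<rho> m where "\<rho> < 1" and
    "\<And>j A. m \<le> j \<Longrightarrow> A \<in> sets (hist j) \<Longrightarrow> (\<And>\<omega>. \<omega> \<in> A \<Longrightarrow> \<delta> \<le> comp_mean (Z 0 \<omega>)) \<Longrightarrow>
      prob (A \<inter> {\<omega> \<in> space M. \<forall>n\<ge>j. comp_mean (Z n \<omega>) \<le> \<epsilon>}) \<le> \<rho> * prob A"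
proof -
  obtain c m1 where c: "0 < c" and small: "\<And>k A. m1 \<le> k \<Longrightarrow> A \<in> sets (hist k) \<Longrightarrow>
      prob (A \<inter> {\<omega> \<in> space M. \<forall>n\<ge>k. comp_mean (Z n \<omega>) \<le> \<epsilon>}) \<le>
      expectation (\<lambda>\<omega>. indicator A \<omega> * exp (- (c * real k * comp_mean (Z k \<omega>))))"
    using prob_stays_small_le[OF \<gamma> lower r01] by blast
  obtain m2 where m2: "\<And>n. n \<ge> m2 \<Longrightarrow> 0 < n \<and> 1 / (2 * real n) \<le> r n \<and> r n \<le> 2 / real n"
    using r_eventually_bounds unfolding eventually_sequentially by blast
  \<comment> \<open>One success at time \<open>k\<close> raises the mean to at least
    \<open>r (k - 1) / CARD('n)\<close>. As \<open>r (k - 1)\<close> is at least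
    \<open>1 / (2 * (k - 1))\<close>, the product \<open>k * comp_mean (Z k)\<close> is at least
    \<open>1 / (2 * CARD('n))\<close>.\<close>
  define \<rho> where "\<rho> = exp (- (c / (2 * CARD('n))))"
  define E where "E j = {\<omega> \<in> space M. \<forall>n\<ge>j. comp_mean (Z n \<omega>) \<le> \<epsilon>}" for j
  have E_meas: "E j \<in> events" for j unfolding E_def by (rule stays_small_set_measurable)
  have \<rho>: "0 \<le> \<rho>" "\<rho> < 1" using c by (auto simp: \<rho>_def)
  have "prob (A \<inter> E j) \<le> \<rho> * prob A"
    if j: "max m1 m2 \<le> j" and A: "A \<in> sets (hist j)"
      and A_ge: "\<And>\<omega>. \<omega> \<in> A \<Longrightarrow> \<delta> \<le> comp_mean (Z 0 \<omega>)" for j A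
  proof -
    \<comment> \<open>\<open>N\<close> records successes only, so that leaving it means a success
      has happened. \<open>D\<close> also demands a small mean, as the decay of the probability
      requires; on \<open>E j\<close> the two coincide.\<close>
    define D where "D i = {\<omega> \<in> A. \<forall>l<i. comp_mean (Z (l + j) \<omega>) \<le> \<epsilon> \<and> comp_mean (I (Suc (l + j)) \<omega>) = 0}" for i
    define N where "N i = {\<omega> \<in> A. \<forall>l<i. comp_mean (I (Suc (l + j)) \<omega>) = 0}" for i
    have A_sub: "A \<subseteq> space M" using sets.sets_into_space[OF A] by simp
    have N_Suc: "N (Suc i) = N i \<inter> {\<omega> \<in> space M. comp_mean (I (Suc (i + j)) \<omega>) = 0}" for i
      using A_sub by (auto simp: N_def less_Suc_eq)
    have N_meas: "N i \<in> sets (hist (i + j))" for i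
    proof (induction i)
      case 0
      then show ?case using A by (simp add: N_def)
    next
      case (Suc i)
      show ?case
        unfolding N_Suc add_Suc by (intro sets.Int mean_I_eq_0_set hist_sets_mono[OF Suc]) auto
    qed
    note ev = hist_sets_events[OF A] hist_sets_events[OF N_meas] E_meas
    have "prob ((A - N i) \<inter> E j) \<le> \<rho> * prob (A - N i)" for i
    proof (induction i)
      case 0
      then show ?case by (simp add: N_def)
    next
      case (Suc i)
      define k where "k = Suc (i + j)"
      \<comment> \<open>The first success occurs exactly at time \<open>k\<close>. This event is
        known at time \<open>k\<close>, so the escape estimate can be restarted there, and
        \<open>E j\<close> is contained in \<open>E k\<close>.\<close>
      define W where "W = N i - N (Suc i)"
      have W: "W \<in> sets (hist k)"
        unfolding W_def k_def
        by (intro sets.Diff hist_sets_mono[OF N_meas[of i]] N_meas[of "Suc i", simplified]) auto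
      have W_ev: "W \<in> events" using hist_sets_events[OF W] .
      have W_sub: "W \<subseteq> space M" using sets.sets_into_space[OF W] by simp
      have split: "A - N (Suc i) = (A - N i) \<union> W" "(A - N i) \<inter> W = {}"
        by (auto simp: W_def N_def)
      have W_ge: "1 / (2 * CARD('n)) \<le> real k * comp_mean (Z k \<omega>)" if "\<omega> \<in> W" for \<omega>
      proof -
        have w: "\<omega> \<in> space M" using that W_sub by blast
        have "comp_mean (I k \<omega>) \<noteq> 0" using that w by (auto simp: W_def N_Suc k_def)
        then have I_ge: "1 / CARD('n) \<le> comp_mean (I k \<omega>)" unfolding k_def by (rule comp_mean_I_ge[OF w])
        have r: "0 < i + j" "1 / (2 * real (i + j)) \<le> r (i + j)" using m2[of "i + j"] j by auto
        have "1 / (2 * CARD('n)) = real (i + j) * (1 / (2 * real (i + j)) * (1 / CARD('n)))"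
          using r(1) by (simp del: of_nat_add)
        also have "\<dots> \<le> real k * (r (i + j) * comp_mean (I k \<omega>))"
          using r I_ge r01[of "i + j"] by (intro mult_mono) (auto simp: k_def)
        also have "\<dots> \<le> real k * comp_mean (Z k \<omega>)"
          using comp_mean_Z_Suc[OF w, of "i + j"] comp_mean_Z_bounds[OF w, of "i + j"] r01[of "i + j"]
          by (intro mult_left_mono) (auto simp: k_def)
        finally show ?thesis .
      qed
      have "prob (W \<inter> E j) \<le> prob (W \<inter> E k)"
      proof (rule finite_measure_mono)
        show "W \<inter> E j \<subseteq> W \<inter> E k" unfolding E_def k_def by auto
        show "W \<inter> E k \<in> events" using W_ev E_meas by (rule sets.Int)
      qed
      also have "\<dots> \<le> expectation (\<lambda>\<omega>. indicator W \<omega> * exp (- (c * real k * comp_mean (Z k \<omega>))))"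
        unfolding E_def using j by (intro small W) (auto simp: k_def)
      also have "\<dots> \<le> expectation (\<lambda>\<omega>. \<rho> * indicator W \<omega>)"
      proof (rule integral_mono)
        show "integrable M (\<lambda>\<omega>. indicator W \<omega> * exp (- (c * real k * comp_mean (Z k \<omega>))))"
        proof (rule integrable_bounded_history[where n = k and B = 1])
          show "(\<lambda>\<omega>. indicator W \<omega> * exp (- (c * real k * comp_mean (Z k \<omega>)))) \<in> borel_measurable (hist k)"
            using W comp_mean_measurable_history[of k] by measurable
          show "\<bar>indicator W \<omega> * exp (- (c * real k * comp_mean (Z k \<omega>)))\<bar> \<le> 1" if "\<omega> \<in> space M" for \<omega>
            using comp_mean_Z_bounds[OF that, of k] c by (auto simp: indicator_def)
        qed
        show "integrable M (\<lambda>\<omega>. \<rho> * indicator W \<omega>)" using W_ev by (auto simp: emeasure_eq_measure)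
        fix \<omega>
        show "indicator W \<omega> * exp (- (c * real k * comp_mean (Z k \<omega>))) \<le> \<rho> * indicator W \<omega>"
        proof (cases "\<omega> \<in> W")
          case True
          then have "c * (1 / (2 * CARD('n))) \<le> c * (real k * comp_mean (Z k \<omega>))"
            using W_ge c by (intro mult_left_mono) auto
          then show ?thesis using True by (simp add: \<rho>_def mult.assoc)
        qed simp
      qed
      also have "\<dots> = \<rho> * prob W" using W_ev by simp
      finally have W_le: "prob (W \<inter> E j) \<le> \<rho> * prob W" .
      have "prob ((A - N (Suc i)) \<inter> E j) = prob ((A - N i) \<inter> E j) + prob (W \<inter> E j)"
        unfolding split(1) Int_Un_distrib2 using split(2) ev W_ev
        by (intro finite_measure_Union) auto
      also have "\<dots> \<le> \<rho> * (prob (A - N i) + prob W)"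
        using Suc W_le by (simp add: distrib_left)
      also have "prob (A - N i) + prob W = prob (A - N (Suc i))"
        unfolding split(1) using split(2) ev W_ev by (intro finite_measure_Union[symmetric]) auto
      finally show ?case .
    qed
    moreover have "prob (A \<inter> E j) \<le> prob ((A - N i) \<inter> E j) + prob (D i)" for i
    proof -
      have D_ev: "D i \<in> events"
      proof -
        have [measurable]: "(\<lambda>\<omega>. comp_mean (Z n \<omega>)) \<in> borel_measurable M"
          "(\<lambda>\<omega>. comp_mean (I (Suc n) \<omega>)) \<in> borel_measurable M" for n
          using measurable_from_subalg[OF subalgebra_history comp_mean_measurable_history]
            measurable_from_subalg[OF subalgebra_history comp_mean_I_measurable[of n "Suc n"]] by auto
        have "D i = A \<inter> {\<omega> \<in> space M. \<forall>l<i. comp_mean (Z (l + j) \<omega>) \<le> \<epsilon> \<and>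
            comp_mean (I (Suc (l + j)) \<omega>) = 0}"
          using A_sub by (auto simp: D_def)
        then show ?thesis using ev(1) by simp
      qed
      have "prob (A \<inter> E j) \<le> prob (((A - N i) \<inter> E j) \<union> D i)"
      proof (rule finite_measure_mono)
        show "A \<inter> E j \<subseteq> ((A - N i) \<inter> E j) \<union> D i" unfolding D_def N_def E_def by auto
        show "((A - N i) \<inter> E j) \<union> D i \<in> events"
          by (intro sets.Un sets.Int sets.Diff ev D_ev)
      qed
      also have "\<dots> \<le> prob ((A - N i) \<inter> E j) + prob (D i)"
        using ev D_ev by (intro measure_Un_le) auto
      finally show ?thesis .
    qed
    moreover have "\<rho> * prob (A - N i) \<le> \<rho> * prob A" for i
      using \<rho> ev by (intro mult_left_mono finite_measure_mono) auto
    ultimately have le: "prob (A \<inter> E j) \<le> \<rho> * prob A + prob (D i)" for i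
      by (meson add_mono_thms_linordered_semiring(3) order_trans)
    have "(\<lambda>i. prob (D i)) \<longlonglongrightarrow> 0"
      unfolding D_def
    proof (rule prob_no_success_tendsto_zero[OF _ r01 r_prod \<delta> A A_ge])
      fix n \<omega> assume w: "\<omega> \<in> space M" "comp_mean (Z n \<omega>) \<le> \<epsilon>"
      have "comp_mean (Z n \<omega>) \<le> \<gamma> * comp_mean (Z n \<omega>)"
        using mult_right_mono[of 1 \<gamma> "comp_mean (Z n \<omega>)"] \<gamma> comp_mean_Z_bounds[OF w(1), of n] by simp
      then show "comp_mean (Z n \<omega>) \<le> mean_win_prob n \<omega>" using lower[OF w] by linarith
    qed
    then have "(\<lambda>i. \<rho> * prob A + prob (D i)) \<longlonglongrightarrow> \<rho> * prob A + 0" by (intro tendsto_intros)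
    then show ?thesis using le by (intro LIMSEQ_le_const) auto
  qed
  then show ?thesis using that[of \<rho> "max m1 m2"] \<rho> unfolding E_def by blast
qed

text \<open>The event \<open>G\<close> of staying small is the decreasing limit of events
  \<open>B i\<close> of finite horizon. The contraction gives
  \<open>prob G \<le> \<rho> * prob (B i)\<close>, in the limit
  \<open>prob G \<le> \<rho> * prob G\<close>, hence \<open>prob G = 0\<close>. This is an
  elementary substitute for Levy's zero-one law.\<close>

lemma AE_frequently_comp_mean_gt:
  assumes \<gamma>: "1 < \<gamma>"
    and lower: "\<And>n \<omega>. \<omega> \<in> space M \<Longrightarrow> comp_mean (Z n \<omega>) \<le> \<epsilon> \<Longrightarrow>
      \<gamma> * comp_mean (Z n \<omega>) \<le> mean_win_prob n \<omega>"
    and r01: "\<And>n. 0 \<le> r n \<and> r n < 1"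
    and r_prod: "\<not> summable (\<lambda>n. \<Prod>k<n. 1 - r k)"
  shows "AE \<omega> in M. Z 0 \<omega> \<noteq> 0 \<longrightarrow> frequently (\<lambda>n. \<epsilon> < comp_mean (Z n \<omega>)) sequentially"
proof -
  have null: "AE \<omega> in M. \<not> (\<delta> \<le> comp_mean (Z 0 \<omega>) \<and> (\<forall>n\<ge>m. comp_mean (Z n \<omega>) \<le> \<epsilon>))"
    if \<delta>: "0 < \<delta>" for \<delta> m
  proof -
    obtain \<rho> m' where \<rho>: "\<rho> < 1" and contr:
      "\<And>j A. m' \<le> j \<Longrightarrow> A \<in> sets (hist j) \<Longrightarrow> (\<And>\<omega>. \<omega> \<in> A \<Longrightarrow> \<delta> \<le> comp_mean (Z 0 \<omega>)) \<Longrightarrow>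
        prob (A \<inter> {\<omega> \<in> space M. \<forall>n\<ge>j. comp_mean (Z n \<omega>) \<le> \<epsilon>}) \<le> \<rho> * prob A"
      using prob_stays_small_contraction[OF \<gamma> lower r01 r_prod \<delta>] by blast
    \<comment> \<open>The horizon \<open>m' + i + m\<close> is at least \<open>m'\<close>, the time
      from which the contraction is valid.\<close>
    define B where "B i = {\<omega> \<in> space M. \<delta> \<le> comp_mean (Z 0 \<omega>) \<and>
      (\<forall>l\<le>m' + i. comp_mean (Z (l + m) \<omega>) \<le> \<epsilon>)}" for i
    define G where "G = {\<omega> \<in> space M. \<delta> \<le> comp_mean (Z 0 \<omega>) \<and> (\<forall>n\<ge>m. comp_mean (Z n \<omega>) \<le> \<epsilon>)}"
    have B_meas: "B i \<in> sets (hist (m' + i + m))" for i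
    proof -
      have *: "{\<omega> \<in> space (hist (n + m)). \<delta> \<le> comp_mean (Z 0 \<omega>) \<and>
          (\<forall>l\<le>n. comp_mean (Z (l + m) \<omega>) \<le> \<epsilon>)} \<in> sets (hist (n + m))" for n
      proof (induction n)
        case 0
        have [measurable]: "(\<lambda>\<omega>. comp_mean (Z 0 \<omega>)) \<in> borel_measurable (hist m)"
          "(\<lambda>\<omega>. comp_mean (Z m \<omega>)) \<in> borel_measurable (hist m)"
          by (auto intro: comp_mean_Z_measurable)
        have "{\<omega> \<in> space (hist m). \<delta> \<le> comp_mean (Z 0 \<omega>) \<and> comp_mean (Z m \<omega>) \<le> \<epsilon>} \<in> sets (hist m)"
          by measurable
        then show ?case by simp
      next
        case (Suc n)
        have [measurable]: "(\<lambda>\<omega>. comp_mean (Z (Suc n + m) \<omega>)) \<in> borel_measurable (hist (Suc n + m))"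
          by (rule comp_mean_measurable_history)
        have "{\<omega> \<in> space (hist (Suc n + m)). \<delta> \<le> comp_mean (Z 0 \<omega>) \<and>
            (\<forall>l\<le>Suc n. comp_mean (Z (l + m) \<omega>) \<le> \<epsilon>)} =
          {\<omega> \<in> space (hist (n + m)). \<delta> \<le> comp_mean (Z 0 \<omega>) \<and>
            (\<forall>l\<le>n. comp_mean (Z (l + m) \<omega>) \<le> \<epsilon>)} \<inter>
          {\<omega> \<in> space (hist (Suc n + m)). comp_mean (Z (Suc n + m) \<omega>) \<le> \<epsilon>}"
          by (auto simp: le_Suc_eq)
        also have "\<dots> \<in> sets (hist (Suc n + m))"
        proof (rule sets.Int)
          show "{\<omega> \<in> space (hist (n + m)). \<delta> \<le> comp_mean (Z 0 \<omega>) \<and>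
              (\<forall>l\<le>n. comp_mean (Z (l + m) \<omega>) \<le> \<epsilon>)} \<in> sets (hist (Suc n + m))"
            using hist_sets_mono[OF Suc] by simp
        qed measurable
        finally show ?case .
      qed
      show ?thesis using *[of "m' + i"] by (simp add: B_def)
    qed
    have "decseq B" by (auto simp: B_def decseq_def)
    then have "(\<lambda>i. prob (B i)) \<longlonglongrightarrow> prob (\<Inter>i. B i)"
      using hist_sets_events[OF B_meas] by (intro finite_Lim_measure_decseq) auto
    also have "(\<Inter>i. B i) = G"
    proof -
      have "comp_mean (Z n \<omega>) \<le> \<epsilon>"
        if "\<forall>i. \<forall>l\<le>m' + i. comp_mean (Z (l + m) \<omega>) \<le> \<epsilon>" "m \<le> n" for \<omega> n
        using that(1)[rule_format, of "n - m" "n - m"] that(2) by simp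
      then show ?thesis unfolding B_def G_def by auto
    qed
    finally have lim: "(\<lambda>i. prob (B i)) \<longlonglongrightarrow> prob G" .
    have "prob G \<le> \<rho> * prob (B i)" for i
    proof -
      define E where "E = {\<omega> \<in> space M. \<forall>n\<ge>m' + i + m. comp_mean (Z n \<omega>) \<le> \<epsilon>}"
      have "prob G \<le> prob (B i \<inter> E)"
      proof (rule finite_measure_mono)
        show "G \<subseteq> B i \<inter> E" unfolding G_def B_def E_def by auto
        show "B i \<inter> E \<in> events"
          unfolding E_def by (intro sets.Int hist_sets_events[OF B_meas] stays_small_set_measurable)
      qed
      also have "\<dots> \<le> \<rho> * prob (B i)"
        unfolding E_def using B_meas[of i] by (intro contr) (auto simp: B_def)
      finally show ?thesis .
    qed
    moreover have "(\<lambda>i. \<rho> * prob (B i)) \<longlonglongrightarrow> \<rho> * prob G" by (intro tendsto_intros lim)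
    ultimately have "prob G \<le> \<rho> * prob G" by (intro LIMSEQ_le_const) auto
    then have "(1 - \<rho>) * prob G \<le> 0" by (simp add: algebra_simps)
    then have "prob G \<le> 0" using \<rho> by (simp add: mult_le_0_iff)
    then have "prob G = 0" using measure_nonneg[of M G] by linarith
    moreover have "G \<in> events"
    proof -
      have [measurable]: "(\<lambda>\<omega>. comp_mean (Z n \<omega>)) \<in> borel_measurable M" for n
        using measurable_from_subalg[OF subalgebra_history comp_mean_measurable_history] .
      show ?thesis unfolding G_def by measurable
    qed
    ultimately have "AE \<omega> in M. \<omega> \<notin> G" using prob_eq_0 by blast
    then show ?thesis by (rule AE_mp) (auto simp: G_def)
  qed
  \<comment> \<open>A nonzero start has a positive mean; countably many thresholds \<delta> and
    starting times \<open>m\<close> cover all cases.\<close>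
  have "AE \<omega> in M. \<forall>i m. \<not> (1 / real (Suc i) \<le> comp_mean (Z 0 \<omega>) \<and> (\<forall>n\<ge>m. comp_mean (Z n \<omega>) \<le> \<epsilon>))"
    unfolding AE_all_countable by (intro allI null) simp
  then show ?thesis
  proof (rule AE_mp, intro AE_I2 impI)
    fix \<omega> assume w: "\<omega> \<in> space M" and "Z 0 \<omega> \<noteq> 0"
      and none: "\<forall>i m. \<not> (1 / real (Suc i) \<le> comp_mean (Z 0 \<omega>) \<and> (\<forall>n\<ge>m. comp_mean (Z n \<omega>) \<le> \<epsilon>))"
    obtain h where "Z 0 \<omega> $ h \<noteq> 0" using \<open>Z 0 \<omega> \<noteq> 0\<close> by (auto simp: vec_eq_iff)
    then have "0 < Z 0 \<omega> $ h" using Z_range[OF w, of 0 h] by auto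
    also have "\<dots> \<le> (\<Sum>i\<in>UNIV. Z 0 \<omega> $ i)"
      using Z_range[OF w, of 0] by (intro member_le_sum) auto
    finally have "0 < comp_mean (Z 0 \<omega>)" unfolding comp_mean_def by simp
    then obtain i where "1 / real (Suc i) < comp_mean (Z 0 \<omega>)"
      using reals_Archimedean by (auto simp: inverse_eq_divide)
    then have "\<not> (\<forall>n\<ge>m. comp_mean (Z n \<omega>) \<le> \<epsilon>)" for m using none by (auto intro: less_imp_le)
    then show "frequently (\<lambda>n. \<epsilon> < comp_mean (Z n \<omega>)) sequentially"
      unfolding frequently_sequentially by (meson not_le)
  qed
qed

end

subsection \<open>The saturating reinforcement function\<close>

context interacting_system
begin

lemma Z_tendsto_vec:
  assumes "\<And>h. (\<lambda>n. Z n \<omega> $ h) \<longlonglongrightarrow> c"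
  shows "(\<lambda>n. Z n \<omega>) \<longlonglongrightarrow> c *\<^sub>R 1"
  using assms by (intro vec_tendstoI) simp

lemma I_averages_tendsto_vec:
  assumes w: "\<omega> \<in> space M" and Z: "\<And>h. (\<lambda>n. Z n \<omega> $ h) \<longlonglongrightarrow> c"
  shows "(\<lambda>n. (1 / real n) *\<^sub>R (\<Sum>k=1..n. I k \<omega>)) \<longlonglongrightarrow> c *\<^sub>R 1"
proof (rule vec_tendstoI)
  fix h
  have "(\<lambda>n. (\<Sum>k=1..n. I k \<omega> $ h) / real n) \<longlonglongrightarrow> c"
  proof (rule averages_tendsto[OF Z_Suc[OF w] _ r_asymp Z])
    show "\<bar>I (Suc n) \<omega> $ h - Z n \<omega> $ h\<bar> \<le> 1" for n
      using I_bounds[OF w, of n h] Z_range[OF w, of n h] by (auto simp: abs_le_iff)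
  qed
  then show "(\<lambda>n. ((1 / real n) *\<^sub>R (\<Sum>k=1..n. I k \<omega>)) $ h) \<longlonglongrightarrow> (c *\<^sub>R (1 :: real ^ 'n)) $ h"
    by simp
qed

end

section \<open>Sign of the drift for the saturating function\<close>

text \<open>Clearing the positive denominator reduces the sign of the drift to that of a quadratic,
  whose larger root is \<open>zhat\<close>.\<close>

lemma sat_drift_eq:
  assumes "0 < \<theta>" "0 < \<theta> * xs" "0 \<le> x"
  shows "\<theta> * (x + xs) * (\<beta> * q + (1 - \<alpha> - \<beta>) * sat \<theta> xs x - (1 - \<alpha>) * x) =
    - ((1 - \<alpha>) * \<theta> * x\<^sup>2 + lin_coeff \<alpha> \<beta> q \<theta> xs * x - \<beta> * \<theta> * q * xs)"
proof -
  define S where "S = sat \<theta> xs x"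
  have "\<theta> * (x + xs) \<noteq> 0" using assms by (auto simp: zero_less_mult_iff)
  then have S: "\<theta> * (x + xs) * S = x" by (simp add: S_def sat_def)
  have "\<theta> * (x + xs) * (\<beta> * q + (1 - \<alpha> - \<beta>) * S - (1 - \<alpha>) * x) =
      \<theta> * (x + xs) * (\<beta> * q) + (1 - \<alpha> - \<beta>) * (\<theta> * (x + xs) * S) - \<theta> * (x + xs) * ((1 - \<alpha>) * x)"
    by (simp add: algebra_simps)
  then show ?thesis
    unfolding S S_def[symmetric] by (simp add: lin_coeff_def algebra_simps power2_eq_square)
qed

text \<open>For positive leading and negative constant coefficient the roots have opposite signs, so the
  sign of the quadratic on \<open>[0, \<infinity>)\<close> changes exactly at the larger root.\<close>

lemma quadratic_sign:
  fixes a b c x :: real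
  assumes "0 < a" "0 < c" "0 \<le> x"
  defines "z \<equiv> (- b + sqrt (b\<^sup>2 + 4 * a * c)) / (2 * a)"
  shows "0 < z" and "0 \<le> a * x\<^sup>2 + b * x - c \<longleftrightarrow> z \<le> x" and "a * x\<^sup>2 + b * x - c \<le> 0 \<longleftrightarrow> x \<le> z"
    and "0 < a * x\<^sup>2 + b * x - c \<longleftrightarrow> z < x"
proof -
  define s where "s = sqrt (b\<^sup>2 + 4 * a * c)"
  have ac: "0 < 4 * a * c" using assms by simp
  then have s2: "s\<^sup>2 = b\<^sup>2 + 4 * a * c" by (simp add: s_def)
  have "\<bar>b\<bar> < s" unfolding s_def using ac by (intro real_less_rsqrt) simp
  then have b: "b < s" "- b < s" by auto
  show z: "0 < z" unfolding z_def s_def[symmetric] using b \<open>0 < a\<close> by simp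
  define w where "w = (b + s) / (2 * a)"
  have w: "0 < w" using b \<open>0 < a\<close> by (simp add: w_def)
  have az: "2 * a * z = s - b" and aw: "2 * a * w = s + b"
    using \<open>0 < a\<close> by (auto simp: z_def w_def s_def)
  have "4 * a * (a * x\<^sup>2 + b * x - c) = (2 * a * x)\<^sup>2 + 2 * b * (2 * a * x) - 4 * a * c"
    by (simp add: algebra_simps power2_eq_square)
  also have "\<dots> = (2 * a * x - (s - b)) * (2 * a * x + (s + b))"
    using s2 by (simp add: algebra_simps power2_eq_square)
  also have "\<dots> = 4 * a * (a * ((x - z) * (x + w)))"
    unfolding az[symmetric] aw[symmetric] by (simp add: algebra_simps)
  finally have eq: "a * x\<^sup>2 + b * x - c = a * ((x - z) * (x + w))" using \<open>0 < a\<close> by simp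
  have xw: "0 < x + w" using w \<open>0 \<le> x\<close> by simp
  show "0 \<le> a * x\<^sup>2 + b * x - c \<longleftrightarrow> z \<le> x"
    unfolding eq using \<open>0 < a\<close> xw by (simp add: zero_le_mult_iff)
  show "a * x\<^sup>2 + b * x - c \<le> 0 \<longleftrightarrow> x \<le> z"
    unfolding eq using \<open>0 < a\<close> xw by (simp add: mult_le_0_iff)
  show "0 < a * x\<^sup>2 + b * x - c \<longleftrightarrow> z < x"
    unfolding eq using \<open>0 < a\<close> xw by (simp add: zero_less_mult_iff)
qed

lemma zhat_sign:
  assumes "0 < \<theta>" "0 < \<theta> * xs" "0 < \<beta>" "0 < q" "\<alpha> < 1" "0 \<le> x"
  shows "0 < zhat \<alpha> \<beta> q \<theta> xs"
    and "0 \<le> (1 - \<alpha>) * \<theta> * x\<^sup>2 + lin_coeff \<alpha> \<beta> q \<theta> xs * x - \<beta> * \<theta> * q * xs \<longleftrightarrow> zhat \<alpha> \<beta> q \<theta> xs \<le> x"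
    and "(1 - \<alpha>) * \<theta> * x\<^sup>2 + lin_coeff \<alpha> \<beta> q \<theta> xs * x - \<beta> * \<theta> * q * xs \<le> 0 \<longleftrightarrow> x \<le> zhat \<alpha> \<beta> q \<theta> xs"
    and "0 < (1 - \<alpha>) * \<theta> * x\<^sup>2 + lin_coeff \<alpha> \<beta> q \<theta> xs * x - \<beta> * \<theta> * q * xs \<longleftrightarrow> zhat \<alpha> \<beta> q \<theta> xs < x"
proof -
  have a: "0 < (1 - \<alpha>) * \<theta>" using assms by simp
  have xs: "0 < xs" using assms by (auto simp: zero_less_mult_iff)
  then have c: "0 < \<beta> * \<theta> * q * xs" using assms by simp
  have z: "zhat \<alpha> \<beta> q \<theta> xs = (- lin_coeff \<alpha> \<beta> q \<theta> xs
      + sqrt ((lin_coeff \<alpha> \<beta> q \<theta> xs)\<^sup>2 + 4 * ((1 - \<alpha>) * \<theta>) * (\<beta> * \<theta> * q * xs))) / (2 * ((1 - \<alpha>) * \<theta>))"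
    by (simp add: zhat_def discr_def power2_eq_square mult_ac)
  show "0 < zhat \<alpha> \<beta> q \<theta> xs"
    "0 \<le> (1 - \<alpha>) * \<theta> * x\<^sup>2 + lin_coeff \<alpha> \<beta> q \<theta> xs * x - \<beta> * \<theta> * q * xs \<longleftrightarrow> zhat \<alpha> \<beta> q \<theta> xs \<le> x"
    "(1 - \<alpha>) * \<theta> * x\<^sup>2 + lin_coeff \<alpha> \<beta> q \<theta> xs * x - \<beta> * \<theta> * q * xs \<le> 0 \<longleftrightarrow> x \<le> zhat \<alpha> \<beta> q \<theta> xs"
    "0 < (1 - \<alpha>) * \<theta> * x\<^sup>2 + lin_coeff \<alpha> \<beta> q \<theta> xs * x - \<beta> * \<theta> * q * xs \<longleftrightarrow> zhat \<alpha> \<beta> q \<theta> xs < x"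
    unfolding z using quadratic_sign[OF a c \<open>0 \<le> x\<close>, of "lin_coeff \<alpha> \<beta> q \<theta> xs"] by blast+
qed

text \<open>The quadratic has at \<open>1\<close> the value
  \<open>(1 - \<alpha> - \<beta>) * (t - 1) + \<beta> * t * (1 - q)\<close> with
  \<open>t = \<theta> + \<theta> * xs\<close>. Both summands are nonnegative, and both vanish
  exactly if \<open>q = 1\<close> and \<open>t = 1\<close>, in which case the root is
  \<open>1\<close>.\<close>

lemma zhat_range:
  assumes "0 < \<theta>" "0 < \<theta> * xs" "1 - \<theta> \<le> \<theta> * xs" "0 < \<beta>" "0 < q" "q \<le> 1" "\<alpha> < 1" "\<alpha> + \<beta> < 1"
  shows "zhat \<alpha> \<beta> q \<theta> xs \<in> {0<..1}"
    and "q < 1 \<or> 1 - \<theta> < \<theta> * xs \<Longrightarrow> zhat \<alpha> \<beta> q \<theta> xs \<in> {0<..<1}"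
proof -
  define t where "t = \<theta> + \<theta> * xs"
  have at_1: "(1 - \<alpha>) * \<theta> * 1\<^sup>2 + lin_coeff \<alpha> \<beta> q \<theta> xs * 1 - \<beta> * \<theta> * q * xs =
      (1 - \<alpha> - \<beta>) * (t - 1) + \<beta> * t * (1 - q)"
    by (simp add: lin_coeff_def t_def algebra_simps)
  have t: "1 \<le> t" "0 < t" using assms by (auto simp: t_def)
  have nn: "0 \<le> (1 - \<alpha> - \<beta>) * (t - 1)" "0 \<le> \<beta> * t * (1 - q)" using t assms by auto
  note zs = zhat_sign[OF assms(1,2,4,5,7) zero_le_one, unfolded at_1]
  show "zhat \<alpha> \<beta> q \<theta> xs \<in> {0<..1}" using zs nn by simp
  assume "q < 1 \<or> 1 - \<theta> < \<theta> * xs"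
  then have "0 < (1 - \<alpha> - \<beta>) * (t - 1) \<or> 0 < \<beta> * t * (1 - q)"
    using t assms by (auto simp: t_def)
  then have "0 < (1 - \<alpha> - \<beta>) * (t - 1) + \<beta> * t * (1 - q)" using nn by auto
  then show "zhat \<alpha> \<beta> q \<theta> xs \<in> {0<..<1}" using zs by simp
qed

text \<open>The conditions on the steps guard the absorbing state \<open>0\<close> in the
  conditioned case. A step \<open>r n = 1\<close> could lead there at once, and with summable
  products the absence of any success could have positive probability, again with limit
  \<open>0\<close>.\<close>

theorem theorem3p1:
  fixes M :: "'a measure" and Z I :: "nat \<Rightarrow> 'a \<Rightarrow> real ^ 'n"
    and \<alpha> \<beta> q \<theta> xs :: real and r :: "nat \<Rightarrow> real"
  assumes model: "interacting_system M \<alpha> \<beta> q (sat \<theta> xs) r Z I"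
    and "0 < \<theta>" and "0 < \<theta> * xs" and "\<theta> * xs \<le> 1" and "1 - \<theta> \<le> \<theta> * xs"
    and Z0_pos: "\<beta> = 0 \<Longrightarrow> \<theta> * xs < 1 \<Longrightarrow> 0 < measure M {\<omega> \<in> space M. Z 0 \<omega> \<noteq> 0}"
    and r_range: "\<And>n. \<beta> = 0 \<Longrightarrow> \<theta> * xs < 1 \<Longrightarrow> 0 \<le> r n \<and> r n < 1"
    and r_prod: "\<beta> = 0 \<Longrightarrow> \<theta> * xs < 1 \<Longrightarrow> \<not> summable (\<lambda>n. \<Prod>k<n. 1 - r k)"
  shows "as_synchronizes (Phat M \<beta> \<theta> xs Z) Z
       \<and> predictable (Phat M \<beta> \<theta> xs Z) Z
       \<and> (AE \<omega> in Phat M \<beta> \<theta> xs Z.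
             (\<lambda>n. Z n \<omega>) \<longlonglongrightarrow> z_inf \<alpha> \<beta> q \<theta> xs *\<^sub>R 1
           \<and> (\<lambda>n. (1 / real n) *\<^sub>R (\<Sum>k=1..n. I k \<omega>)) \<longlonglongrightarrow> z_inf \<alpha> \<beta> q \<theta> xs *\<^sub>R 1)
       \<and> (0 < \<beta> \<longrightarrow> zhat \<alpha> \<beta> q \<theta> xs \<in> {0<..1}
             \<and> (q < 1 \<or> 1 - \<theta> < \<theta> * xs \<longrightarrow> zhat \<alpha> \<beta> q \<theta> xs \<in> {0<..<1}))"
proof -
  interpret interacting_system M \<alpha> \<beta> q "sat \<theta> xs" r Z I by (rule model)
  define z where "z = z_inf \<alpha> \<beta> q \<theta> xs"
  have xs: "0 < xs" using \<open>0 < \<theta>\<close> \<open>0 < \<theta> * xs\<close> by (auto simp: zero_less_mult_iff)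
  have drift_eq: "\<theta> * (x + xs) * drift x =
      - ((1 - \<alpha>) * \<theta> * x\<^sup>2 + lin_coeff \<alpha> \<beta> q \<theta> xs * x - \<beta> * \<theta> * q * xs)" if "0 \<le> x" for x
    unfolding drift_def using sat_drift_eq[OF assms(2,3) that] .
  have pos: "0 < \<theta> * (x + xs)" if "0 \<le> x" for x
    using that xs \<open>0 < \<theta>\<close> by simp
  \<comment> \<open>The disjunction leaves out the second zero \<open>x = 0\<close>, which exists
    for \<beta> = 0; \<open>max 0 z\<close> stands in as long as \<open>0 \<le> z\<close> is not yet
    established.\<close>
  have drift_sign: "0 < \<beta> \<or> 0 < x \<Longrightarrow> drift x \<le> 0 \<Longrightarrow> z \<le> x" "0 \<le> drift x \<Longrightarrow> x \<le> max 0 z"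
    "x \<le> z \<Longrightarrow> 0 \<le> drift x" if x: "0 \<le> x" for x
  proof -
    define Q where "Q = (1 - \<alpha>) * \<theta> * x\<^sup>2 + lin_coeff \<alpha> \<beta> q \<theta> xs * x - \<beta> * \<theta> * q * xs"
    have "drift x = - Q / (\<theta> * (x + xs))"
      using drift_eq[OF x] pos[OF x] unfolding Q_def[symmetric]
      by (metis less_irrefl nonzero_mult_div_cancel_left)
    then have s: "drift x \<le> 0 \<longleftrightarrow> 0 \<le> Q" "0 \<le> drift x \<longleftrightarrow> Q \<le> 0"
      using pos[OF x] by (simp_all add: divide_le_0_iff zero_le_divide_iff)
    have "(0 < \<beta> \<or> 0 < x \<longrightarrow> 0 \<le> Q \<longrightarrow> z \<le> x) \<and> (Q \<le> 0 \<longrightarrow> x \<le> max 0 z) \<and> (x \<le> z \<longrightarrow> Q \<le> 0)"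
    proof (cases "\<beta> = 0")
      case True
      have z_eq: "\<theta> * z = 1 - \<theta> * xs" using True \<open>0 < \<theta>\<close> by (simp add: z_def z_inf_def)
      have lin: "lin_coeff \<alpha> \<beta> q \<theta> xs = - ((1 - \<alpha>) * (\<theta> * z))"
        unfolding z_eq using True by (simp add: lin_coeff_def algebra_simps)
      have "Q = (1 - \<alpha>) * \<theta> * (x * (x - z))"
        unfolding Q_def lin using True by (simp add: algebra_simps power2_eq_square)
      moreover have "0 < (1 - \<alpha>) * \<theta>" using alpha \<open>0 < \<theta>\<close> by simp
      ultimately have "0 \<le> Q \<longleftrightarrow> 0 \<le> x * (x - z)" "Q \<le> 0 \<longleftrightarrow> x * (x - z) \<le> 0"
        by (simp_all add: zero_le_mult_iff[of "(1 - \<alpha>) * \<theta>"] mult_le_0_iff[of "(1 - \<alpha>) * \<theta>"])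
      then show ?thesis using x True by (auto simp: zero_le_mult_iff mult_le_0_iff)
    next
      case False
      then have "0 < \<beta>" using beta by simp
      then have "z = zhat \<alpha> \<beta> q \<theta> xs" by (simp add: z_def z_inf_def)
      then show ?thesis
        using zhat_sign[OF assms(2,3) \<open>0 < \<beta>\<close> q(1) alpha(2) x] unfolding Q_def[symmetric] by auto
    qed
    then show "0 < \<beta> \<or> 0 < x \<Longrightarrow> drift x \<le> 0 \<Longrightarrow> z \<le> x" "0 \<le> drift x \<Longrightarrow> x \<le> max 0 z"
      "x \<le> z \<Longrightarrow> 0 \<le> drift x"
      unfolding s by auto
  qed
  have z_nonneg: "0 \<le> z"
  proof (cases "\<beta> = 0")
    case True
    then show ?thesis using assms(2,4) by (simp add: z_def z_inf_def)
  next
    case False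
    then have "0 < \<beta>" using beta by simp
    then show ?thesis
      using zhat_sign(1)[OF assms(2,3) \<open>0 < \<beta>\<close> q(1) alpha(2) order_refl] by (simp add: z_def z_inf_def)
  qed
  have noise_conv: "AE \<omega> in M. \<forall>h. convergent (\<lambda>n. noise \<omega> n h)"
    using AE_noise_convergent unfolding noise_def .
  have Z_conv: "AE \<omega> in Phat M \<beta> \<theta> xs Z. \<omega> \<in> space M \<and> (\<forall>h. (\<lambda>n. Z n \<omega> $ h) \<longlonglongrightarrow> z)"
  proof (cases "\<beta> = 0 \<and> \<theta> * xs < 1")
    case False
    then have "Phat M \<beta> \<theta> xs Z = M" by (auto simp: Phat_def)
    moreover have "AE \<omega> in M. \<omega> \<in> space M \<and> (\<forall>h. (\<lambda>n. Z n \<omega> $ h) \<longlonglongrightarrow> z)"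
      using noise_conv AE_space
    proof eventually_elim
      case (elim \<omega>)
      have "z \<le> x" if "0 \<le> x" "drift x \<le> 0" for x
      proof (cases "\<beta> = 0")
        \<comment> \<open>Here \<open>\<theta> * xs = 1\<close>: the two zeros of the drift merge at
          \<open>0\<close>.\<close>
        case True
        then have "z = 0" using False assms(4) by (simp add: z_def z_inf_def)
        then show ?thesis using that by simp
      next
        case False
        then show ?thesis using drift_sign(1)[OF that(1)] that(2) beta by simp
      qed
      then have "(\<lambda>n. Z n \<omega> $ h) \<longlonglongrightarrow> z" for h
        using elim drift_sign(2) z_nonneg Z_range[of \<omega>]
        by (intro Z_tendsto[where lo = 0]) (auto simp: max_absorb2)
      then show ?case using elim by simp
    qed
    ultimately show ?thesis by (simp only:)
  next
    case True
    then have \<beta>: "\<beta> = 0" and \<theta>xs: "\<theta> * xs < 1" by auto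
    have \<alpha>: "0 < \<alpha>" using alpha_beta \<beta> by simp
    have z_eq: "\<theta> * z = 1 - \<theta> * xs" using \<beta> \<open>0 < \<theta>\<close> by (simp add: z_def z_inf_def)
    then have "0 < \<theta> * z" using \<theta>xs by simp
    then have z_pos: "0 < z" using \<open>0 < \<theta>\<close> by (simp add: zero_less_mult_iff)
    \<comment> \<open>A mean of at most \<epsilon> bounds the sum of the components, hence each of
      them, by \<open>z / 2\<close>.\<close>
    define \<epsilon> where "\<epsilon> = z / (2 * CARD('n))"
    have \<epsilon>: "0 < \<epsilon>" using z_pos by (simp add: \<epsilon>_def)
    \<comment> \<open>The ratio \<open>sat \<theta> xs x / x\<close> decreases in \<open>x\<close>
      and equals \<open>1\<close> at \<open>z\<close>. Its value \<open>K\<close> at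
      \<open>z / 2\<close> therefore exceeds \<open>1\<close> and bounds the ratio from below for
      all positive components.\<close>
    define K where "K = 1 / (\<theta> * (z / 2 + xs))"
    have "\<theta> * (z / 2 + xs) < 1" using z_eq \<theta>xs by (simp add: algebra_simps)
    then have K: "1 < K" using pos[of "z / 2"] z_pos by (simp add: K_def)
    define \<gamma> where "\<gamma> = \<alpha> + (1 - \<alpha>) * K"
    have \<gamma>: "1 < \<gamma>"
    proof -
      have "0 < (1 - \<alpha>) * (K - 1)" using K alpha by simp
      then show ?thesis by (simp add: \<gamma>_def algebra_simps)
    qed
    have lower: "\<gamma> * comp_mean (Z n \<omega>) \<le> mean_win_prob n \<omega>"
      if w: "\<omega> \<in> space M" and small: "comp_mean (Z n \<omega>) \<le> \<epsilon>" for n \<omega>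
    proof -
      have "\<alpha> * comp_mean (Z n \<omega>) + (1 - \<alpha>) * (K * Z n \<omega> $ h) \<le> win_prob n \<omega> h" for h
      proof -
        have zh: "0 \<le> Z n \<omega> $ h" using Z_range[OF w] by simp
        have "Z n \<omega> $ h \<le> (\<Sum>i\<in>UNIV. Z n \<omega> $ i)"
          using Z_range[OF w] by (intro member_le_sum) auto
        also have "\<dots> \<le> z / 2"
          using small by (simp add: comp_mean_def \<epsilon>_def field_simps)
        finally have "\<theta> * (Z n \<omega> $ h + xs) \<le> \<theta> * (z / 2 + xs)"
          using \<open>0 < \<theta>\<close> by (intro mult_left_mono) auto
        then have "K \<le> 1 / (\<theta> * (Z n \<omega> $ h + xs))"
          unfolding K_def using pos[OF zh] by (intro divide_left_mono) auto
        then have "K * Z n \<omega> $ h \<le> sat \<theta> xs (Z n \<omega> $ h)"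
          using mult_right_mono[OF _ zh] by (fastforce simp: sat_def)
        then have "(1 - \<alpha>) * (K * Z n \<omega> $ h) \<le> (1 - \<alpha>) * sat \<theta> xs (Z n \<omega> $ h)"
          using alpha by (intro mult_left_mono) auto
        then show ?thesis unfolding win_prob_def by (simp add: \<beta>)
      qed
      then have "(\<Sum>h\<in>UNIV. \<alpha> * comp_mean (Z n \<omega>) + (1 - \<alpha>) * (K * Z n \<omega> $ h)) / CARD('n)
          \<le> mean_win_prob n \<omega>"
        unfolding mean_win_prob_def by (intro divide_right_mono sum_mono) auto
      also have "(\<Sum>h\<in>UNIV. \<alpha> * comp_mean (Z n \<omega>) + (1 - \<alpha>) * (K * Z n \<omega> $ h)) / CARD('n)
          = \<alpha> * comp_mean (Z n \<omega>) + (1 - \<alpha>) * (K * comp_mean (Z n \<omega>))"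
        by (simp add: comp_mean_def sum.distrib sum_distrib_left[symmetric] add_divide_distrib)
      finally show ?thesis by (simp add: \<gamma>_def algebra_simps)
    qed
    have "AE \<omega> in M. Z 0 \<omega> \<noteq> 0 \<longrightarrow> frequently (\<lambda>n. \<epsilon> < comp_mean (Z n \<omega>)) sequentially"
      using \<gamma> lower r_range[OF \<beta> \<theta>xs] r_prod[OF \<beta> \<theta>xs] by (rule AE_frequently_comp_mean_gt)
    then have "AE \<omega> in M. Z 0 \<omega> \<noteq> 0 \<longrightarrow> \<omega> \<in> space M \<and> (\<forall>h. (\<lambda>n. Z n \<omega> $ h) \<longlonglongrightarrow> z)"
      using noise_conv AE_space
    proof eventually_elim
      case (elim \<omega>)
      then have w: "\<omega> \<in> space M" and conv: "\<And>h. convergent (\<lambda>n. noise \<omega> n h)" by auto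
      show ?case
      proof
        assume "Z 0 \<omega> \<noteq> 0"
        then have freq: "frequently (\<lambda>n. \<epsilon> < comp_mean (Z n \<omega>)) sequentially" using elim by simp
        have "eventually (\<lambda>n. \<epsilon> / 2 \<le> comp_mean (Z n \<omega>)) sequentially"
        proof (rule comp_mean_eventually_ge[OF w conv _ _ freq])
          fix n assume "\<epsilon> / 2 \<le> comp_mean (Z n \<omega>)" "comp_mean (Z n \<omega>) \<le> \<epsilon>"
          then show "comp_mean (Z n \<omega>) \<le> mean_win_prob n \<omega>"
            using lower[OF w, of n] mult_right_mono[OF less_imp_le[OF \<gamma>] comp_mean_Z_bounds(1)[OF w, of n]]
            by simp
        qed (use \<epsilon> in simp)
        then obtain lo where lo: "0 < lo" "eventually (\<lambda>n. \<forall>h. lo \<le> Z n \<omega> $ h) sequentially"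
          using Z_eventually_ge_if_mean_ge[OF w conv \<alpha> z_pos drift_sign(3), of "\<epsilon> / 2"] \<epsilon> by auto
        have "(\<lambda>n. Z n \<omega> $ h) \<longlonglongrightarrow> z" for h
          using w conv less_imp_le[OF lo(1)] lo(2)
        proof (rule Z_tendsto)
          show "z \<le> x" if "lo \<le> x" "drift x \<le> 0" for x
            using drift_sign(1)[of x] that lo(1) by simp
          show "x \<le> z" if "0 \<le> x" "0 \<le> drift x" for x
            using drift_sign(2)[of x] that z_nonneg by (simp add: max_absorb2)
        qed
        then show "\<omega> \<in> space M \<and> (\<forall>h. (\<lambda>n. Z n \<omega> $ h) \<longlonglongrightarrow> z)" using w by simp
      qed
    qed
    moreover have "{\<omega> \<in> space M. Z 0 \<omega> \<noteq> 0} \<in> events"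
      using Z0_measurable by measurable
    ultimately have "AE \<omega> in uniform_measure M {\<omega> \<in> space M. Z 0 \<omega> \<noteq> 0}.
        \<omega> \<in> space M \<and> (\<forall>h. (\<lambda>n. Z n \<omega> $ h) \<longlonglongrightarrow> z)"
      by (intro AE_uniform_measureI) auto
    moreover have "Phat M \<beta> \<theta> xs Z = uniform_measure M {\<omega> \<in> space M. Z 0 \<omega> \<noteq> 0}"
      using True by (simp add: Phat_def)
    ultimately show ?thesis by (simp only:)
  qed
  have lim: "AE \<omega> in Phat M \<beta> \<theta> xs Z. (\<lambda>n. Z n \<omega>) \<longlonglongrightarrow> z *\<^sub>R 1
      \<and> (\<lambda>n. (1 / real n) *\<^sub>R (\<Sum>k=1..n. I k \<omega>)) \<longlonglongrightarrow> z *\<^sub>R 1"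
    using Z_conv by eventually_elim (blast intro: Z_tendsto_vec I_averages_tendsto_vec)
  have "as_synchronizes (Phat M \<beta> \<theta> xs Z) Z"
    unfolding as_synchronizes_def using lim
    by eventually_elim (auto intro!: exI[of _ "z *\<^sub>R 1"])
  moreover have "predictable (Phat M \<beta> \<theta> xs Z) Z"
    unfolding predictable_def using lim by (intro exI[of _ "z *\<^sub>R 1"]) (auto elim: AE_mp)
  moreover have "0 < \<beta> \<longrightarrow> zhat \<alpha> \<beta> q \<theta> xs \<in> {0<..1}
      \<and> (q < 1 \<or> 1 - \<theta> < \<theta> * xs \<longrightarrow> zhat \<alpha> \<beta> q \<theta> xs \<in> {0<..<1})"
    using zhat_range[OF assms(2,3,5) _ q alpha(2) alpha_beta(2)] by blast
  ultimately show ?thesis using lim unfolding z_def by blast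
qed

end
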